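(* For every $n\ge1$, we have $|E_n|=2^{e_n}$ and $|B_n|=|B'_n|=2^{b_n}$, where \[ e_n=\frac{2^n}{3}+\begin{cases}2/3 & n\text{ even},\\ 1/3 & n\text{ odd},\end{cases}\qquad b_n=\frac{2^{n+1}}{3}+\frac n2-\begin{cases}2/3 & n\text{ even},\\ 5/6 & n\text{ odd}.\end{cases} \] In particular, $B_n=B'_n$ for every $n\ge1$. Moreover, the closed basilica group $\overline{B}_\infty$ is precisely the kernel of the homomorphism $P:M_\infty\to\mathbb{Z}_2^\times$, $\sigma\mapsto P(\sigma,x_0)$.
   Context: $T_\infty$ is the infinite binary rooted tree whose nodes at level $m\ge0$ are words of length $m$ over $\{a,b\}$ (root $x_0$ = empty word), each $w$ joined to $wa,wb$; $T_n$ the subtree of words of length $\le n$; $\mathrm{Aut}(T_\infty),\mathrm{Aut}(T_n)$ the root-preserving automorphism groups. $\mathrm{Aut}(T_\infty)$ carries the profinite topology whose basic open sets are cosets of $U_m:=\{\sigma:\sigma$ fixes all nodes of length $\le m\}$. $\mathrm{Par}(\sigma,x)=0$ if $\sigma(xa)=\sigma(x)a$ and $\sigma(xb)=\sigma(x)b$, and $=1$ if $\sigma(xa)=\sigma(x)b$ and $\sigma(xb)=\sigma(x)a$; an automorphism is determined by its values $\mathrm{Par}(\sigma,x)$ at all nodes, which may be chosen freely. For $\sigma\in\mathrm{Aut}(T_\infty)$: $Q(\sigma,x):=\sum_{i\ge0}2^i\sum_{s_1,\ldots,s_i\in\{a,b\}}\mathrm{Par}(\sigma,x\,a\,s_1\,a\,s_2\cdots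 a\,s_i)\in\mathbb{Z}_2$ (concatenated words), $P(\sigma,x):=(-1)^{\mathrm{Par}(\sigma,x)}+2\sum_{t\in\{a,b\}}Q(\sigma,xbt)-2\sum_{t\in\{a,b\}}Q(\sigma,xat)\in\mathbb{Z}_2^\times$. For $\tau\in\mathrm{Aut}(T_n)$ and $x$ of length $m\le n$, $P(\tau,x):=P(\tilde\tau,x)\bmod 2^{\lfloor(n-m+1)/2\rfloor}$ for any extension $\tilde\tau$ of $\tau$ to $T_\infty$. $M_\infty:=\{\sigma\in\mathrm{Aut}(T_\infty):P(\sigma,x)=P(\sigma,x_0)\ \forall x\}$ (a group on which $\sigma\mapsto P(\sigma,x_0)$ is a homomorphism). $M_n:=\{\sigma\in\mathrm{Aut}(T_n):$ for all $m\ge0$ and words $x$ of length $m$, $P(\sigma,x)\equiv P(\sigma,x_0)\pmod{2^{\lfloor(n-m+1)/2\rfloor}}\}$. $B'_n:=\{\sigma\in M_n:P(\sigma,x_0)\equiv1\pmod{2^{\lfloor(n+1)/2\rfloor}}\}$, $E_n:=\{\sigma\in B'_n:\sigma$ fixes all nodes of length $\le n-1\}$. Basilica group: $\boldsymbol\alpha,\boldsymbol\beta\in\mathrm{Aut}(T_\infty)$ are defined by $\mathrm{Par}(\boldsymbol\alpha,b^k)=1$ for every even $k\ge0$ (where $b^k$ is the word of $k$ letters $b$; $b^0$ is the root), $\mathrm{Par}(\boldsymbol\beta,b^k)=1$ for every odd $k$, and $\mathrm{Par}(\boldsymbol\alpha,y)=\mathrm{Par}(\boldsymbol\beta,y)=0$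 at all other nodes $y$. $B_\infty:=\langle\boldsymbol\alpha,\boldsymbol\beta\rangle$, $\overline{B}_\infty$ is its closure in $\mathrm{Aut}(T_\infty)$, and $B_n$ is the image of $B_\infty$ under restriction to $T_n$. *)

theory Defs
  imports
    Complex_Main
    "HOL-Analysis.Abstract_Topology"
    "HOL-Algebra.Bij"
    "HOL-Algebra.Generated_Groups"
    "HOL-Number_Theory.Cong"
begin

section \<open>The ring of 2-adic integers\<close>

text \<open>
  The inverse limit of the rings \<open>\<int>/2\<^sup>k\<int>\<close>: an element is the coherent sequence of its residues
  modulo \<open>2\<^sup>k\<close>, normalised to lie in \<open>{0..<2\<^sup>k}\<close>.
\<close>

typedef two_adic =
  "{r :: nat \<Rightarrow> int. \<forall>k. r k \<in> {0..<2 ^ k} \<and> r (Suc k) mod 2 ^ k = r k}"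
  morphisms residue Abs_two_adic
  by (rule exI[of _ "\<lambda>_. 0"]) simp

setup_lifting type_definition_two_adic

lemma mod_mod_Suc_power_two: "(x mod 2 ^ Suc k) mod 2 ^ k = x mod (2 ^ k :: int)"
  by (rule mod_mod_cancel) simp

lemma residue_range: "0 \<le> residue x k" "residue x k < 2 ^ k"
  using residue[of x] by auto

lemma residue_mod_self: "residue x k mod 2 ^ k = residue x k"
  using residue_range[of x k] by simp

lemma residue_0 [simp]: "residue x 0 = 0"
  using residue_range[of x 0] by simp

lemma residue_Suc: "residue x (Suc k) mod 2 ^ k = residue x k"
  using residue[of x] by auto

instantiation two_adic :: comm_ring_1
begin

lift_definition zero_two_adic :: two_adic is "\<lambda>_. 0"
  by simp

lift_definition one_two_adic :: two_adic is "\<lambda>k. 1 mod 2 ^ k"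
  by (simp only: mod_mod_Suc_power_two) simp

lift_definition plus_two_adic :: "two_adic \<Rightarrow> two_adic \<Rightarrow> two_adic"
  is "\<lambda>r s k. (r k + s k) mod 2 ^ k"
  apply (simp only: mod_mod_Suc_power_two)
  apply (metis atLeastLessThan_iff mod_add_eq pos_mod_bound pos_mod_sign zero_less_numeral zero_less_power)
  done

lift_definition uminus_two_adic :: "two_adic \<Rightarrow> two_adic"
  is "\<lambda>r k. (- r k) mod 2 ^ k"
  apply (simp only: mod_mod_Suc_power_two)
  apply (metis atLeastLessThan_iff mod_minus_eq pos_mod_bound pos_mod_sign zero_less_numeral zero_less_power)
  done

lift_definition minus_two_adic :: "two_adic \<Rightarrow> two_adic \<Rightarrow> two_adic"
  is "\<lambda>r s k. (r k - s k) mod 2 ^ k"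
  apply (simp only: mod_mod_Suc_power_two)
  apply (metis atLeastLessThan_iff mod_diff_eq pos_mod_bound pos_mod_sign zero_less_numeral zero_less_power)
  done

lift_definition times_two_adic :: "two_adic \<Rightarrow> two_adic \<Rightarrow> two_adic"
  is "\<lambda>r s k. (r k * s k) mod 2 ^ k"
  apply (simp only: mod_mod_Suc_power_two)
  apply (metis atLeastLessThan_iff mod_mult_eq pos_mod_bound pos_mod_sign zero_less_numeral zero_less_power)
  done

instance
proof
  fix a b c :: two_adic
  show "a + b + c = a + (b + c)"
    by (rule residue_inject[THEN iffD1], rule ext)
      (simp add: plus_two_adic.rep_eq mod_simps add.assoc)
  show "a + b = b + a"
    by (rule residue_inject[THEN iffD1], rule ext)
      (simp add: plus_two_adic.rep_eq add.commute)
  show "0 + a = a"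
    by (rule residue_inject[THEN iffD1], rule ext)
      (simp add: plus_two_adic.rep_eq zero_two_adic.rep_eq residue_mod_self)
  show "- a + a = 0"
    by (rule residue_inject[THEN iffD1], rule ext)
      (simp add: plus_two_adic.rep_eq uminus_two_adic.rep_eq zero_two_adic.rep_eq mod_simps)
  show "a - b = a + - b"
    by (rule residue_inject[THEN iffD1], rule ext)
      (simp add: plus_two_adic.rep_eq uminus_two_adic.rep_eq minus_two_adic.rep_eq mod_simps)
  show "a * b * c = a * (b * c)"
    by (rule residue_inject[THEN iffD1], rule ext)
      (simp add: times_two_adic.rep_eq mod_simps mult.assoc)
  show "a * b = b * a"
    by (rule residue_inject[THEN iffD1], rule ext)
      (simp add: times_two_adic.rep_eq mult.commute)
  show "1 * a = a"
    by (rule residue_inject[THEN iffD1], rule ext)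
      (simp add: times_two_adic.rep_eq one_two_adic.rep_eq mod_simps residue_mod_self)
  show "(a + b) * c = a * c + b * c"
    by (rule residue_inject[THEN iffD1], rule ext)
      (simp add: times_two_adic.rep_eq plus_two_adic.rep_eq mod_simps distrib_right)
  show "(0 :: two_adic) \<noteq> 1"
  proof
    assume "(0 :: two_adic) = 1"
    then have "residue 0 1 = residue 1 1"
      by simp
    then show False
      by (simp add: zero_two_adic.rep_eq one_two_adic.rep_eq)
  qed
qed

end

lemma residue_mono: "j \<le> k \<Longrightarrow> residue x k mod 2 ^ j = residue x j"
proof (induction k rule: dec_induct)
  case base
  show ?case
    by (rule residue_mod_self)
next
  case (step k)
  have "residue x (Suc k) mod 2 ^ j = residue x (Suc k) mod 2 ^ k mod 2 ^ j"
    using step.hyps by (simp add: mod_mod_cancel le_imp_power_dvd)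
  then show ?case
    by (simp add: residue_Suc step.IH)
qed

text \<open>The 2-adic topology; infinite sums below are \<^const>\<open>suminf\<close> with respect to it.\<close>

instantiation two_adic :: t2_space
begin

definition open_two_adic :: "two_adic set \<Rightarrow> bool" where
  "open_two_adic U \<longleftrightarrow> (\<forall>x\<in>U. \<exists>k. \<forall>y. residue y k = residue x k \<longrightarrow> y \<in> U)"

instance
proof
  show "open (UNIV :: two_adic set)"
    by (simp add: open_two_adic_def)
  show "open (S \<inter> T)" if S: "open S" and T: "open T" for S T :: "two_adic set"
    unfolding open_two_adic_def
  proof
    fix x assume "x \<in> S \<inter> T"
    then obtain j k where j: "\<forall>y. residue y j = residue x j \<longrightarrow> y \<in> S"
      and k: "\<forall>y. residue y k = residue x k \<longrightarrow> y \<in> T"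
      using S T unfolding open_two_adic_def by blast
    have "\<forall>y. residue y (max j k) = residue x (max j k) \<longrightarrow> y \<in> S \<inter> T"
      using j k by (metis IntI max.cobounded1 max.cobounded2 residue_mono)
    then show "\<exists>k. \<forall>y. residue y k = residue x k \<longrightarrow> y \<in> S \<inter> T" ..
  qed
  show "open (\<Union>K)" if "\<forall>S\<in>K. open S" for K :: "two_adic set set"
    using that unfolding open_two_adic_def by (meson Union_iff)
  show "\<exists>U V. open U \<and> open V \<and> x \<in> U \<and> y \<in> V \<and> U \<inter> V = {}"
    if "x \<noteq> y" for x y :: two_adic
  proof -
    obtain k where k: "residue x k \<noteq> residue y k"
      using \<open>x \<noteq> y\<close> by (metis ext residue_inject)
    have op: "open {z. residue z k = c}" for c
      unfolding open_two_adic_def by auto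
    show ?thesis
      by (rule exI[of _ "{z. residue z k = residue x k}"],
          rule exI[of _ "{z. residue z k = residue y k}"]) (use op k in auto)
  qed
qed

end

definition two_adic_units :: "two_adic monoid" where
  "two_adic_units = units_of \<lparr>carrier = UNIV, monoid.mult = (*), one = 1\<rparr>"


section \<open>The binary rooted tree and its automorphisms\<close>

datatype letter = La | Lb

lemma UNIV_letter: "UNIV = {La, Lb}"
  using letter.exhaust by blast

instance letter :: finite
  by standard (simp add: UNIV_letter)

text \<open>The word \<open>w\<close> followed by the letter \<open>s\<close> is the list \<open>w @ [s]\<close>; the root is \<open>[]\<close>.\<close>

type_synonym node = "letter list"

definition adjacent :: "node \<Rightarrow> node \<Rightarrow> bool" where
  "adjacent v w \<longleftrightarrow> (\<exists>s. w = v @ [s] \<or> v = w @ [s])"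

definition nodes :: "nat \<Rightarrow> node set" where
  "nodes n = {w. length w \<le> n}"

text \<open>
  Root-preserving automorphisms of the subtree spanned by \<open>V\<close>; \<open>V = UNIV\<close> gives \<open>T\<^sub>\<infinity>\<close> and
  \<open>V = nodes n\<close> gives \<open>T\<^sub>n\<close>. As \<^const>\<open>Bij\<close> consists of extensional maps, an automorphism of
  \<open>T\<^sub>n\<close> is determined by its values on \<open>nodes n\<close>.
\<close>

definition tree_auts :: "node set \<Rightarrow> (node \<Rightarrow> node) set" where
  "tree_auts V = {\<sigma> \<in> Bij V. \<sigma> [] = [] \<and>
     (\<forall>v\<in>V. \<forall>w\<in>V. adjacent (\<sigma> v) (\<sigma> w) \<longleftrightarrow> adjacent v w)}"

definition Aut_inf :: "(node \<Rightarrow> node) monoid" where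
  "Aut_inf = BijGroup UNIV \<lparr>carrier := tree_auts UNIV\<rparr>"

definition U_lev :: "nat \<Rightarrow> (node \<Rightarrow> node) set" where
  "U_lev m = {\<sigma> \<in> carrier Aut_inf. \<forall>x. length x \<le> m \<longrightarrow> \<sigma> x = x}"

definition Aut_topology :: "(node \<Rightarrow> node) topology" where
  "Aut_topology =
     topology_generated_by {\<sigma> <#\<^bsub>Aut_inf\<^esub> U_lev m | \<sigma> m. \<sigma> \<in> carrier Aut_inf}"


section \<open>The invariants Par, Q and P\<close>

definition Par :: "(node \<Rightarrow> node) \<Rightarrow> node \<Rightarrow> nat" where
  "Par \<sigma> x = (if \<sigma> (x @ [La]) = \<sigma> x @ [La] \<and> \<sigma> (x @ [Lb]) = \<sigma> x @ [Lb] then 0 else 1)"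

definition Q_inv :: "(node \<Rightarrow> node) \<Rightarrow> node \<Rightarrow> two_adic" where
  "Q_inv \<sigma> x =
     (\<Sum>i. 2 ^ i * of_nat (\<Sum>s | length s = i. Par \<sigma> (x @ concat (map (\<lambda>t. [La, t]) s))))"

definition P_inv :: "(node \<Rightarrow> node) \<Rightarrow> node \<Rightarrow> two_adic" where
  "P_inv \<sigma> x = (-1) ^ Par \<sigma> x
     + 2 * (\<Sum>t\<in>{La, Lb}. Q_inv \<sigma> (x @ [Lb, t]))
     - 2 * (\<Sum>t\<in>{La, Lb}. Q_inv \<sigma> (x @ [La, t]))"

definition extends :: "nat \<Rightarrow> (node \<Rightarrow> node) \<Rightarrow> (node \<Rightarrow> node) \<Rightarrow> bool" where
  "extends n \<tau> \<sigma> \<longleftrightarrow> \<sigma> \<in> tree_auts UNIV \<and> restrict \<sigma> (nodes n) = \<tau>"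

text \<open>
  \<open>P(\<tau>, x)\<close> for \<open>\<tau> \<in> Aut(T\<^sub>n)\<close>, as a representative in \<open>{0..<2\<^sup>k}\<close> of a class modulo
  \<open>2\<^sup>k\<close>, where \<open>k = \<lfloor>(n - |x| + 1)/2\<rfloor>\<close>. The class does not depend on the extension; only
  \<open>x \<in> nodes n\<close> is meaningful.
\<close>

definition P_fin :: "nat \<Rightarrow> (node \<Rightarrow> node) \<Rightarrow> node \<Rightarrow> int" where
  "P_fin n \<tau> x = residue (P_inv (SOME \<sigma>. extends n \<tau> \<sigma>) x) ((n - length x + 1) div 2)"


section \<open>The groups\<close>

definition M_inf :: "(node \<Rightarrow> node) monoid" where
  "M_inf = Aut_inf \<lparr>carrier := {\<sigma> \<in> carrier Aut_inf. \<forall>x. P_inv \<sigma> x = P_inv \<sigma> []}\<rparr>"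

definition M_fin :: "nat \<Rightarrow> (node \<Rightarrow> node) set" where
  "M_fin n = {\<sigma> \<in> tree_auts (nodes n).
     \<forall>x\<in>nodes n. [P_fin n \<sigma> x = P_fin n \<sigma> []] (mod 2 ^ ((n - length x + 1) div 2))}"

definition B'_fin :: "nat \<Rightarrow> (node \<Rightarrow> node) set" where
  "B'_fin n = {\<sigma> \<in> M_fin n. [P_fin n \<sigma> [] = 1] (mod 2 ^ ((n + 1) div 2))}"

definition E_fin :: "nat \<Rightarrow> (node \<Rightarrow> node) set" where
  "E_fin n = {\<sigma> \<in> B'_fin n. \<forall>x. length x \<le> n - 1 \<longrightarrow> \<sigma> x = x}"

text \<open>
  An automorphism is determined by its values \<open>Par\<close>, which can be prescribed freely, so the
  definite descriptions below denote.
\<close>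

definition basilica_\<alpha> :: "node \<Rightarrow> node" where
  "basilica_\<alpha> = (THE \<sigma>. \<sigma> \<in> tree_auts UNIV \<and>
     (\<forall>y. Par \<sigma> y = (if \<exists>k. even k \<and> y = replicate k Lb then 1 else 0)))"

definition basilica_\<beta> :: "node \<Rightarrow> node" where
  "basilica_\<beta> = (THE \<sigma>. \<sigma> \<in> tree_auts UNIV \<and>
     (\<forall>y. Par \<sigma> y = (if \<exists>k. odd k \<and> y = replicate k Lb then 1 else 0)))"

definition B_inf :: "(node \<Rightarrow> node) set" where
  "B_inf = generate Aut_inf {basilica_\<alpha>, basilica_\<beta>}"

definition B_inf_closure :: "(node \<Rightarrow> node) set" where
  "B_inf_closure = Aut_topology closure_of B_inf"

definition B_fin :: "nat \<Rightarrow> (node \<Rightarrow> node) set" where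
  "B_fin n = (\<lambda>\<sigma>. restrict \<sigma> (nodes n)) ` B_inf"

definition e_exp :: "nat \<Rightarrow> real" where
  "e_exp n = 2 ^ n / 3 + (if even n then 2 / 3 else 1 / 3)"

definition b_exp :: "nat \<Rightarrow> real" where
  "b_exp n = 2 ^ (n + 1) / 3 + real n / 2 - (if even n then 2 / 3 else 5 / 6)"

end

theory Submission
  imports Defs
begin

text \<open>
  Put \<open>\<phi>(\<sigma>) = Q(\<sigma>, a) + Q(\<sigma>, b)\<close>. As soon as \<open>P(\<sigma>, \<cdot>) = 1\<close> to the precision visible in \<open>T\<^sub>n\<close>, one has
  \<open>Q(\<sigma>\<tau>, x) = Q(\<sigma>, \<tau>x) + Q(\<tau>, x)\<close> to that precision. Hence these \<open>\<sigma>\<close> form a group on which \<open>\<phi>\<close> is a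
  homomorphism modulo \<open>2\<^sup>k\<close>, where \<open>k = \<lfloor>n/2\<rfloor>\<close>, and an automorphism fixing the two nodes of level 1
  belongs to the group of level \<open>n + 1\<close> iff its sections \<open>\<sigma>\<^sub>a, \<sigma>\<^sub>b\<close> belong to that of level \<open>n\<close> and
  \<open>\<phi>(\<sigma>\<^sub>a) \<equiv> \<phi>(\<sigma>\<^sub>b)\<close> modulo \<open>2\<^sup>k\<close>.

  Since \<open>\<beta> = (1, \<alpha>)\<close> and \<open>\<alpha>\<^sup>2 = (\<beta>, \<beta>)\<close>, the group \<open>R\<close> of all \<open>h\<close> with \<open>(1, h) \<in> B\<^sub>\<infinity>\<close> contains \<open>\<alpha>\<close> and is
  normalised by \<open>\<beta>\<close>, so \<open>B\<^sub>\<infinity>\<close> lies in \<open>R\<langle>\<beta>\<rangle>\<close> on every finite level. Now \<open>\<phi>\<close> vanishes on \<open>R\<close>, \<open>\<phi>(\<beta>) = 1\<close>,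
  and \<open>\<beta>\<close> has order dividing \<open>2\<^sup>k\<close> on \<open>T\<^sub>n\<close>; therefore elements of \<open>B\<^sub>\<infinity>\<close> with \<open>\<phi> \<equiv> 0\<close> agree on \<open>T\<^sub>n\<close> with
  elements of \<open>R\<close>. As \<open>R \<times> R \<subseteq> B\<^sub>\<infinity>\<close>, correcting a given automorphism by \<open>\<alpha>\<close> at the root and by powers
  of \<open>\<alpha>\<^sup>2\<close> shows by induction that \<open>B\<^sub>n = B'\<^sub>n\<close>. The section description then gives
  \<open>2\<^sup>k |B\<^bsub>n+1\<^esub>| = 2 |B\<^sub>n|\<^sup>2\<close>, and \<open>|E\<^bsub>n+1\<^esub>| = |B\<^bsub>n+1\<^esub>| / |B\<^sub>n|\<close>.
\<close>

section \<open>Divisibility by powers of two\<close>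

lemma two_adic_eqI:
  assumes "\<And>k. residue x k = residue y k"
  shows "x = y"
  using assms by (simp add: residue_inject[symmetric] ext)

lemma residue_of_nat: "residue (of_nat m) k = int m mod 2 ^ k"
  by (induction m)
    (simp_all add: zero_two_adic.rep_eq plus_two_adic.rep_eq one_two_adic.rep_eq mod_simps)

lemma residue_double: "residue (2 * d) (Suc k) = 2 * residue d k"
proof -
  have "residue (2 * d) (Suc k) = (2 * residue d (Suc k)) mod (2 * 2 ^ k)"
    by (simp only: mult_2[of d] plus_two_adic.rep_eq power_Suc mult_2[of "residue d (Suc k)"])
  also have "\<dots> = 2 * (residue d (Suc k) mod 2 ^ k)"
    by (rule mod_mult_mult1)
  finally show ?thesis
    by (simp add: residue_Suc)
qed

lemma residue_two_power_mult: "residue (2 ^ k * d) (j + k) = 2 ^ k * residue d j"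
proof (induction k)
  case (Suc k)
  have "residue (2 ^ Suc k * d) (j + Suc k) = residue (2 * (2 ^ k * d)) (Suc (j + k))"
    by (simp add: mult.assoc)
  then show ?case
    by (simp only: residue_double Suc.IH) simp
qed simp

text \<open>Bridge between divisibility in the ring and the residues in which \<open>P_fin\<close>
  and the topology are written. The work lies in building the quotient as a coherent sequence of
  residues.\<close>

lemma two_power_dvd_iff: "2 ^ k dvd d \<longleftrightarrow> residue d k = 0"
proof
  assume "2 ^ k dvd d"
  then obtain e where "d = 2 ^ k * e" ..
  then show "residue d k = 0"
    using residue_two_power_mult[of k e 0] by simp
next
  assume 0: "residue d k = 0"
  \<comment> \<open>Division by 2^k shifts the residue sequence by k places: the quotient modulo 2^j
    comes from d modulo 2^(j+k).\<close>
  define r where "r j = residue d (j + k) div 2 ^ k" for j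
  have r: "residue d (j + k) = 2 ^ k * r j" for j
  proof -
    have "residue d (j + k) mod 2 ^ k = 0"
      using residue_mono[of k "j + k" d] 0 by simp
    then show ?thesis
      unfolding r_def using mult_div_mod_eq[of "2 ^ k" "residue d (j + k)"] by linarith
  qed
  have "r (Suc j) mod 2 ^ j = r j" for j
  proof -
    have "2 ^ k * (r (Suc j) mod 2 ^ j) = residue d (Suc (j + k)) mod 2 ^ (j + k)"
      using r[of "Suc j"] by (simp add: power_add mult.commute[of "2 ^ j"] flip: mult_mod_right)
    then show ?thesis
      using r[of j] by (simp add: residue_Suc)
  qed
  moreover have "0 \<le> r j \<and> r j < 2 ^ j" for j
    using residue_range[of d "j + k"]
    by (simp add: r power_add zero_le_mult_iff mult.commute[of "2 ^ j"])
  ultimately have res: "residue (Abs_two_adic r) = r"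
    by (intro Abs_two_adic_inverse) simp
  have "2 ^ k * Abs_two_adic r = d"
  proof (rule two_adic_eqI)
    fix j
    have "residue (2 ^ k * Abs_two_adic r) (j + k) = residue d (j + k)"
      by (simp only: residue_two_power_mult res r)
    then show "residue (2 ^ k * Abs_two_adic r) j = residue d j"
      by (metis residue_mono le_add1)
  qed
  then show "2 ^ k dvd d"
    by (metis dvd_triv_left)
qed

lemma two_power_dvd_diff_iff: "2 ^ k dvd x - y \<longleftrightarrow> residue x k = residue y k"
proof -
  have "(residue x k - residue y k) mod 2 ^ k = 0 \<longleftrightarrow> residue x k mod 2 ^ k = residue y k mod 2 ^ k"
    by (simp only: mod_eq_dvd_iff dvd_eq_mod_eq_0)
  then show ?thesis
    by (simp add: two_power_dvd_iff minus_two_adic.rep_eq residue_mod_self)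
qed

text \<open>Each factor 2 is worth one power of two. As \<open>Q_inv_rec\<close> descends two levels
  per factor 2, this is what ties precision to half the number of visible levels.\<close>

lemma two_power_dvd_double_iff: "2 ^ Suc k dvd 2 * d \<longleftrightarrow> 2 ^ k dvd (d :: two_adic)"
  unfolding two_power_dvd_iff residue_double by simp

lemma two_adic_eq_if_dvd:
  fixes x y :: two_adic
  assumes "\<And>k. 2 ^ k dvd x - y"
  shows "x = y"
  using assms by (intro two_adic_eqI) (simp add: two_power_dvd_diff_iff)

text \<open>\<open>suminf\<close> is meaningful only for a convergent series. Divisibility of the
  i-th term by 2^i makes the partial sums stabilise modulo every 2^k, which yields the limit
  together with the error bound.\<close>

lemma two_power_dvd_suminf:
  fixes f :: "nat \<Rightarrow> two_adic"
  assumes "\<And>i. 2 ^ i dvd f i"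
  shows "2 ^ k dvd suminf f - (\<Sum>i<k. f i)"
proof -
  have tail: "residue (\<Sum>i<n. f i) k = residue (\<Sum>i<k. f i) k" if "k \<le> n" for n k
  proof -
    have "(\<Sum>i<n. f i) - (\<Sum>i<k. f i) = (\<Sum>i\<in>{k..<n}. f i)"
      using that sum_diff_nat_ivl[of 0 k n f] by (simp add: lessThan_atLeast0)
    moreover have "2 ^ k dvd (\<Sum>i\<in>{k..<n}. f i)"
      by (intro dvd_sum) (auto intro: dvd_trans[OF le_imp_power_dvd assms])
    ultimately show ?thesis
      by (simp add: two_power_dvd_diff_iff[symmetric])
  qed
  \<comment> \<open>From index k on the partial sums agree modulo 2^k, so the k-th residue of the
    limit can be read off the k-th partial sum.\<close>
  define r where "r k = residue (\<Sum>i<k. f i) k" for k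
  have "r (Suc k) mod 2 ^ k = r k" for k
    unfolding r_def residue_Suc by (rule tail) simp
  then have r: "residue (Abs_two_adic r) = r"
    by (intro Abs_two_adic_inverse) (simp add: r_def residue_range)
  have "f sums Abs_two_adic r"
    unfolding sums_def
  proof (rule topological_tendstoI)
    fix U :: "two_adic set"
    assume "open U" "Abs_two_adic r \<in> U"
    then obtain k where "\<forall>y. residue y k = residue (Abs_two_adic r) k \<longrightarrow> y \<in> U"
      unfolding open_two_adic_def by blast
    then show "eventually (\<lambda>n. (\<Sum>i<n. f i) \<in> U) sequentially"
      unfolding eventually_sequentially r unfolding r_def using tail by blast
  qed
  then show ?thesis
    by (simp add: sums_unique[symmetric] two_power_dvd_diff_iff r) (simp add: r_def)
qed

text \<open>Split off the first pair a s_1 of every word in the series. The congruences for Q below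
  are proved by induction along this recursion, two levels at a time.\<close>

lemma Q_inv_rec:
  "Q_inv \<sigma> x = of_nat (Par \<sigma> x) + 2 * (Q_inv \<sigma> (x @ [La, La]) + Q_inv \<sigma> (x @ [La, Lb]))"
proof (rule two_adic_eq_if_dvd)
  fix k
  define c where "c i x = (\<Sum>s | length s = i. Par \<sigma> (x @ concat (map (\<lambda>t. [La, t]) s)))"
    for i x
  define S where "S k x = (\<Sum>i<k. 2 ^ i * of_nat (c i x) :: two_adic)" for k x
  have Q: "2 ^ k dvd Q_inv \<sigma> x - S k x" for k x
    unfolding Q_inv_def S_def c_def by (rule two_power_dvd_suminf) simp
  have "{s :: letter list. length s = Suc i} = (#) La ` {s. length s = i} \<union> (#) Lb ` {s. length s = i}"
    for i
    by (auto simp: length_Suc_conv image_iff) (metis letter.exhaust)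
  moreover have "finite {s :: letter list. length s = i}" for i
    using finite_lists_length_eq[of "UNIV :: letter set" i] by simp
  ultimately have "c (Suc i) x = c i (x @ [La, La]) + c i (x @ [La, Lb])" for i x
    unfolding c_def by (simp, subst sum.union_disjoint) (auto simp: sum.reindex)
  moreover have "c 0 x = Par \<sigma> x"
    by (simp add: c_def)
  ultimately have S: "S (Suc k) x = of_nat (Par \<sigma> x) + 2 * (S k (x @ [La, La]) + S k (x @ [La, Lb]))"
    unfolding S_def sum.lessThan_Suc_shift
    by (simp add: sum_distrib_left distrib_left mult.assoc sum.distrib)
  \<comment> \<open>An error divisible by 2^k two levels down is divisible by 2^(k+1) after
    doubling; hence truncation at \<open>Suc k\<close> at x matches truncation at k below.\<close>
  have "2 ^ Suc k dvd 2 * ((Q_inv \<sigma> (x @ [La, La]) - S k (x @ [La, La]))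
      + (Q_inv \<sigma> (x @ [La, Lb]) - S k (x @ [La, Lb])))"
    unfolding two_power_dvd_double_iff by (intro dvd_add Q)
  from dvd_diff[OF Q[of "Suc k" x] this]
  have "2 ^ Suc k dvd Q_inv \<sigma> x - (of_nat (Par \<sigma> x)
      + 2 * (Q_inv \<sigma> (x @ [La, La]) + Q_inv \<sigma> (x @ [La, Lb])))"
    unfolding S by (simp add: algebra_simps)
  then show "2 ^ k dvd Q_inv \<sigma> x - (of_nat (Par \<sigma> x)
      + 2 * (Q_inv \<sigma> (x @ [La, La]) + Q_inv \<sigma> (x @ [La, Lb])))"
    by (rule dvd_trans[OF le_imp_power_dvd, rotated]) simp
qed

section \<open>Automorphisms of the tree\<close>

fun opp :: "letter \<Rightarrow> letter" where
  "opp La = Lb"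
| "opp Lb = La"

lemma opp_opp [simp]: "opp (opp s) = s"
  by (cases s) auto

lemma opp_neq [simp]: "opp s \<noteq> s"
  by (cases s) auto

lemma all_letter: "(\<forall>s. R s) \<longleftrightarrow> R La \<and> R Lb"
  by (metis letter.exhaust)

lemma Nil_in_nodes [simp]: "[] \<in> nodes n"
  by (simp add: nodes_def)

text \<open>The image of a child of x is adjacent to the image of x, so it is a child or the parent
  of it. The parent is already the image of the parent of x, which injectivity excludes. The closure
  condition on \<open>V\<close> covers both \<open>UNIV\<close> and \<open>nodes n\<close>.\<close>

lemma tree_auts_child:
  assumes \<tau>: "\<tau> \<in> tree_auts V" and V: "\<And>x s. x @ [s] \<in> V \<Longrightarrow> x \<in> V"
  shows "x @ [s] \<in> V \<Longrightarrow> \<exists>t. \<tau> (x @ [s]) = \<tau> x @ [t]"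
proof (induction x arbitrary: s rule: rev_induct)
  case Nil
  then have "adjacent (\<tau> []) (\<tau> [s])"
    using \<tau> V[of "[]" s] by (auto simp: tree_auts_def adjacent_def)
  then show ?case
    using \<tau> by (auto simp: tree_auts_def adjacent_def)
next
  case (snoc r y)
  have in_V: "y @ [r] \<in> V" "y \<in> V"
    using V snoc.prems by blast+
  have inj: "inj_on \<tau> V"
    using \<tau> by (auto simp: tree_auts_def Bij_def bij_betw_def)
  obtain t' where t': "\<tau> (y @ [r]) = \<tau> y @ [t']"
    using snoc.IH in_V by blast
  have "adjacent (y @ [r]) ((y @ [r]) @ [s])"
    unfolding adjacent_def by blast
  then have "adjacent (\<tau> (y @ [r])) (\<tau> ((y @ [r]) @ [s]))"
    using \<tau> snoc.prems in_V unfolding tree_auts_def by blast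
  moreover have "\<tau> ((y @ [r]) @ [s]) \<noteq> \<tau> y"
    using inj_onD[OF inj, of "(y @ [r]) @ [s]" y] snoc.prems in_V by auto
  ultimately show ?case
    using t' unfolding adjacent_def by (metis butlast_snoc)
qed

lemma tree_auts_step:
  assumes \<tau>: "\<tau> \<in> tree_auts V" and V: "\<And>x s. x @ [s] \<in> V \<Longrightarrow> x \<in> V"
    and x: "\<And>s. x @ [s] \<in> V"
  shows "\<exists>p. \<forall>s. \<tau> (x @ [s]) = \<tau> x @ [if p then opp s else s]"
proof -
  obtain s t where st: "\<tau> (x @ [La]) = \<tau> x @ [s]" "\<tau> (x @ [Lb]) = \<tau> x @ [t]"
    using tree_auts_child[OF \<tau> V] x by meson
  have "inj_on \<tau> V"
    using \<tau> by (auto simp: tree_auts_def Bij_def bij_betw_def)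
  then have "\<tau> (x @ [La]) \<noteq> \<tau> (x @ [Lb])"
    using x by (auto dest: inj_onD)
  then have "s \<noteq> t"
    using st by auto
  then show ?thesis
    using st by (cases s; cases t) (auto simp: all_letter intro: exI[of _ False] exI[of _ True])
qed

section \<open>Local criterion for automorphisms: keep or swap the two children of every
  node\<close>

context
  fixes \<sigma> :: "node \<Rightarrow> node"
  assumes root: "\<sigma> [] = []"
    and step: "\<And>x. \<exists>p. \<forall>s. \<sigma> (x @ [s]) = \<sigma> x @ [if p then opp s else s]"
begin

lemma step_length: "length (\<sigma> w) = length w"
proof (induction w rule: rev_induct)
  case (snoc s x)
  then show ?case
    using step[of x] by auto
qed (simp add: root)

lemma step_bij: "bij \<sigma>"
proof (rule bijI)
  have "\<sigma> v = \<sigma> w \<Longrightarrow> v = w" for v w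
  proof (induction v arbitrary: w rule: rev_induct)
    case Nil
    then show ?case
      by (metis length_0_conv step_length)
  next
    case (snoc s x)
    then obtain y t where w: "w = y @ [t]"
      by (metis length_0_conv rev_exhaust snoc_eq_iff_butlast step_length)
    obtain p q where p: "\<forall>s. \<sigma> (x @ [s]) = \<sigma> x @ [if p then opp s else s]"
      and q: "\<forall>s. \<sigma> (y @ [s]) = \<sigma> y @ [if q then opp s else s]"
      using step by blast
    have "\<sigma> x = \<sigma> y"
      using p q snoc.prems w by simp
    then have "x = y"
      by (rule snoc.IH)
    then have "(if p then opp s else s) = (if p then opp t else t)"
      using p snoc.prems w by auto
    then have "s = t"
      by (metis opp_opp)
    with \<open>x = y\<close> w show ?case
      by simp
  qed
  then show "inj \<sigma>"
    by (rule injI)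
  have "\<exists>v. \<sigma> v = w" for w
  proof (induction w rule: rev_induct)
    case (snoc s x)
    then obtain v where v: "\<sigma> v = x"
      by blast
    obtain p where "\<forall>s. \<sigma> (v @ [s]) = \<sigma> v @ [if p then opp s else s]"
      using step by blast
    then have "\<sigma> (v @ [if p then opp s else s]) = x @ [s]"
      by (simp add: v)
    then show ?case ..
  qed (use root in blast)
  then show "surj \<sigma>"
    by (metis surjI)
qed

lemma step_adjacent: "adjacent (\<sigma> v) (\<sigma> w) \<longleftrightarrow> adjacent v w"
proof -
  have child: "\<exists>s. w = v @ [s]" if "\<sigma> w = \<sigma> v @ [t]" for v w t
  proof -
    obtain p where "\<forall>s. \<sigma> (v @ [s]) = \<sigma> v @ [if p then opp s else s]"
      using step by blast
    \<comment> \<open>The child of the image of v that equals the image of w is also hit by a child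
      of v; bijectivity identifies that child with w.\<close>
    then have "\<sigma> (v @ [if p then opp t else t]) = \<sigma> w"
      by (simp add: that)
    then show ?thesis
      using step_bij by (metis bij_pointE)
  qed
  have parent: "\<exists>t. \<sigma> (v @ [s]) = \<sigma> v @ [t]" for v s
    using step by blast
  show ?thesis
    unfolding adjacent_def using child parent by metis
qed

lemma step_restrict: "restrict \<sigma> (nodes n) \<in> tree_auts (nodes n)"
proof -
  have "\<sigma> ` nodes n = nodes n"
  proof
    show "nodes n \<subseteq> \<sigma> ` nodes n"
      using step_length bij_is_surj[OF step_bij] unfolding nodes_def
      by (metis (mono_tags, lifting) image_eqI mem_Collect_eq subsetI surjD)
  qed (auto simp: nodes_def step_length)
  moreover have "inj_on \<sigma> (nodes n)"
    using step_bij by (metis bij_is_inj inj_on_subset subset_UNIV)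
  ultimately have "bij_betw (restrict \<sigma> (nodes n)) (nodes n) (nodes n)"
    by (auto simp: bij_betw_def inj_on_def)
  then show ?thesis
    by (simp add: tree_auts_def Bij_def root step_adjacent)
qed

lemma step_tree_auts: "\<sigma> \<in> tree_auts UNIV"
  using step_bij by (simp add: tree_auts_def Bij_def root step_adjacent)

end

lemma tree_auts_root: "\<sigma> \<in> tree_auts V \<Longrightarrow> \<sigma> [] = []"
  by (simp add: tree_auts_def)

lemma tree_auts_UNIV_step:
  "\<sigma> \<in> tree_auts UNIV \<Longrightarrow> \<exists>p. \<forall>s. \<sigma> (x @ [s]) = \<sigma> x @ [if p then opp s else s]"
  by (rule tree_auts_step) auto

lemma tree_auts_length: "\<sigma> \<in> tree_auts UNIV \<Longrightarrow> length (\<sigma> w) = length w"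
  by (rule step_length[OF tree_auts_root tree_auts_UNIV_step])

lemma tree_auts_restrict:
  "\<sigma> \<in> tree_auts UNIV \<Longrightarrow> restrict \<sigma> (nodes n) \<in> tree_auts (nodes n)"
  by (rule step_restrict[OF tree_auts_root tree_auts_UNIV_step])

lemma tree_auts_bij: "\<sigma> \<in> tree_auts UNIV \<Longrightarrow> bij \<sigma>"
  by (simp add: tree_auts_def Bij_def)

lemma extends_exists:
  assumes \<tau>: "\<tau> \<in> tree_auts (nodes n)"
  shows "\<exists>\<sigma>. extends n \<tau> \<sigma>"
proof -
  \<comment> \<open>Act by \<tau> on the first n letters and copy the rest, so no node of level at
    least n has its children swapped.\<close>
  define \<sigma> where "\<sigma> w = \<tau> (take n w) @ drop n w" for w
  have "\<sigma> \<in> tree_auts UNIV"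
  proof (rule step_tree_auts)
    show "\<sigma> [] = []"
      using \<tau> by (simp add: \<sigma>_def tree_auts_def)
    show "\<exists>p. \<forall>s. \<sigma> (x @ [s]) = \<sigma> x @ [if p then opp s else s]" for x
    proof (cases "length x < n")
      case True
      then have "\<exists>p. \<forall>s. \<tau> (x @ [s]) = \<tau> x @ [if p then opp s else s]"
        by (intro tree_auts_step[OF \<tau>]) (auto simp: nodes_def)
      with True show ?thesis
        by (simp add: \<sigma>_def)
    next
      case False
      then show ?thesis
        by (intro exI[of _ False]) (simp add: \<sigma>_def)
    qed
  qed
  moreover have "restrict \<sigma> (nodes n) = \<tau>"
  proof
    fix w
    \<comment> \<open>Outside \<open>nodes n\<close> both sides are \<open>undefined\<close>,
      because \<open>Bij\<close> consists of extensional maps.\<close>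
    show "restrict \<sigma> (nodes n) w = \<tau> w"
      using \<tau> by (cases "w \<in> nodes n")
        (auto simp: \<sigma>_def nodes_def tree_auts_def Bij_def extensional_def)
  qed
  ultimately show ?thesis
    unfolding extends_def by blast
qed

lemma tree_auts_snoc:
  assumes "\<sigma> \<in> tree_auts UNIV"
  shows "\<sigma> (x @ [s]) = \<sigma> x @ [if Par \<sigma> x = 0 then s else opp s]"
proof -
  obtain p where "\<forall>s. \<sigma> (x @ [s]) = \<sigma> x @ [if p then opp s else s]"
    using tree_auts_UNIV_step[OF assms] by blast
  then show ?thesis
    by (simp add: Par_def)
qed

lemma Par_cases: "Par \<sigma> x = 0 \<or> Par \<sigma> x = 1"
  by (simp add: Par_def)

lemma Par_eq_0_iff:
  "\<sigma> \<in> tree_auts UNIV \<Longrightarrow> Par \<sigma> x = 0 \<longleftrightarrow> \<sigma> (x @ [s]) = \<sigma> x @ [s]"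
  using tree_auts_snoc[of \<sigma> x s] by simp

lemma tree_auts_eqI:
  assumes \<sigma>: "\<sigma> \<in> tree_auts UNIV" and \<tau>: "\<tau> \<in> tree_auts UNIV"
    and "\<And>y. Par \<sigma> y = Par \<tau> y"
  shows "\<sigma> = \<tau>"
proof
  fix w
  show "\<sigma> w = \<tau> w"
    by (induction w rule: rev_induct)
      (simp_all add: tree_auts_root[OF \<sigma>] tree_auts_root[OF \<tau>] assms
        tree_auts_snoc[OF \<sigma>] tree_auts_snoc[OF \<tau>])
qed

lemma tree_auts_id: "id \<in> tree_auts UNIV"
  by (rule step_tree_auts) (auto intro: exI[of _ False])

lemma tree_auts_comp:
  assumes \<sigma>: "\<sigma> \<in> tree_auts UNIV" and \<tau>: "\<tau> \<in> tree_auts UNIV"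
  shows "\<sigma> \<circ> \<tau> \<in> tree_auts UNIV"
proof (rule step_tree_auts)
  show "\<exists>p. \<forall>s. (\<sigma> \<circ> \<tau>) (x @ [s]) = (\<sigma> \<circ> \<tau>) x @ [if p then opp s else s]" for x
    by (rule exI[of _ "(Par \<sigma> (\<tau> x) = 0) \<noteq> (Par \<tau> x = 0)"])
      (auto simp: tree_auts_snoc[OF \<sigma>] tree_auts_snoc[OF \<tau>])
qed (simp add: tree_auts_root[OF \<sigma>] tree_auts_root[OF \<tau>])

lemma tree_auts_inv:
  assumes \<sigma>: "\<sigma> \<in> tree_auts UNIV"
  shows "inv_into UNIV \<sigma> \<in> tree_auts UNIV"
proof -
  have "surj \<sigma>" "inj \<sigma>"
    using tree_auts_bij[OF \<sigma>] by (auto simp: bij_def)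
  then show ?thesis
    using \<sigma> bij_imp_bij_inv[OF tree_auts_bij[OF \<sigma>]] unfolding tree_auts_def Bij_def
    by (simp add: inv_f_eq) (metis surj_f_inv_f)
qed

text \<open>Addition modulo 2, written as a case distinction because \<open>Par\<close> takes values
  in the natural numbers.\<close>

lemma Par_comp:
  assumes \<sigma>: "\<sigma> \<in> tree_auts UNIV" and \<tau>: "\<tau> \<in> tree_auts UNIV"
  shows "Par (\<sigma> \<circ> \<tau>) x = (if Par \<tau> x = 0 then Par \<sigma> (\<tau> x) else 1 - Par \<sigma> (\<tau> x))"
proof -
  have "Par (\<sigma> \<circ> \<tau>) x = 0 \<longleftrightarrow> (Par \<sigma> (\<tau> x) = 0) = (Par \<tau> x = 0)"
    using Par_eq_0_iff[OF tree_auts_comp[OF \<sigma> \<tau>], of x La]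
    by (auto simp: tree_auts_snoc[OF \<sigma>] tree_auts_snoc[OF \<tau>])
  then show ?thesis
    using Par_cases[of "\<sigma> \<circ> \<tau>" x] Par_cases[of \<sigma> "\<tau> x"] Par_cases[of \<tau> x] by auto
qed

section \<open>Self-similarity\<close>

text \<open>The section of \<sigma> at a node of level 1. By \<open>tree_auts_Cons\<close> the
  letter dropped by \<open>tl\<close> depends on s only, so nothing about the action below s is
  lost.\<close>

definition sec :: "letter \<Rightarrow> (node \<Rightarrow> node) \<Rightarrow> node \<Rightarrow> node" where
  "sec s \<sigma> w = tl (\<sigma> (s # w))"

text \<open>The pair (\<sigma>, \<tau>) in the notation of wreath recursion.\<close>

fun glue :: "(node \<Rightarrow> node) \<Rightarrow> (node \<Rightarrow> node) \<Rightarrow> node \<Rightarrow> node" where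
  "glue \<sigma> \<tau> [] = []"
| "glue \<sigma> \<tau> (La # w) = La # \<sigma> w"
| "glue \<sigma> \<tau> (Lb # w) = Lb # \<tau> w"

lemma tree_auts_Cons:
  assumes \<sigma>: "\<sigma> \<in> tree_auts UNIV"
  shows "\<sigma> (s # w) = (if Par \<sigma> [] = 0 then s else opp s) # sec s \<sigma> w"
proof (induction w rule: rev_induct)
  case Nil
  then show ?case
    using tree_auts_snoc[OF \<sigma>, of "[]" s] by (simp add: sec_def tree_auts_root[OF \<sigma>])
next
  case (snoc t x)
  obtain c z where z: "\<sigma> (s # x) = c # z"
    using tree_auts_length[OF \<sigma>, of "s # x"] by (cases "\<sigma> (s # x)") auto
  then have "c = (if Par \<sigma> [] = 0 then s else opp s)"
    using snoc by simp
  then show ?case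
    using z tree_auts_snoc[OF \<sigma>, of "s # x" t] by (simp add: sec_def)
qed

lemma sec_snoc:
  assumes \<sigma>: "\<sigma> \<in> tree_auts UNIV"
  shows "sec s \<sigma> (x @ [t]) = sec s \<sigma> x @ [if Par \<sigma> (s # x) = 0 then t else opp t]"
  using tree_auts_snoc[OF \<sigma>, of "s # x" t] tree_auts_Cons[OF \<sigma>, of s x]
    tree_auts_Cons[OF \<sigma>, of s "x @ [t]"] by simp

lemma sec_tree_auts:
  assumes \<sigma>: "\<sigma> \<in> tree_auts UNIV"
  shows "sec s \<sigma> \<in> tree_auts UNIV"
proof (rule step_tree_auts)
  show "sec s \<sigma> [] = []"
    using tree_auts_length[OF \<sigma>, of "[s]"] by (cases "\<sigma> [s]") (simp_all add: sec_def)
  show "\<exists>p. \<forall>t. sec s \<sigma> (x @ [t]) = sec s \<sigma> x @ [if p then opp t else t]" for x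
    by (rule exI[of _ "Par \<sigma> (s # x) \<noteq> 0"]) (simp add: sec_snoc[OF \<sigma>])
qed

lemma Par_sec:
  assumes \<sigma>: "\<sigma> \<in> tree_auts UNIV"
  shows "Par (sec s \<sigma>) x = Par \<sigma> (s # x)"
proof -
  have "Par (sec s \<sigma>) x = 0 \<longleftrightarrow> Par \<sigma> (s # x) = 0"
    using Par_eq_0_iff[OF sec_tree_auts[OF \<sigma>], of s x La] by (simp add: sec_snoc[OF \<sigma>])
  then show ?thesis
    using Par_cases[of "sec s \<sigma>" x] Par_cases[of \<sigma> "s # x"] by auto
qed

lemma Q_inv_sec: "\<sigma> \<in> tree_auts UNIV \<Longrightarrow> Q_inv (sec s \<sigma>) x = Q_inv \<sigma> (s # x)"
  by (simp add: Q_inv_def Par_sec)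

lemma P_inv_sec: "\<sigma> \<in> tree_auts UNIV \<Longrightarrow> P_inv (sec s \<sigma>) x = P_inv \<sigma> (s # x)"
  by (simp add: P_inv_def Par_sec Q_inv_sec)

lemma glue_tree_auts:
  assumes "\<sigma> \<in> tree_auts UNIV" "\<tau> \<in> tree_auts UNIV"
  shows "glue \<sigma> \<tau> \<in> tree_auts UNIV"
proof (rule step_tree_auts)
  show "\<exists>p. \<forall>t. glue \<sigma> \<tau> (x @ [t]) = glue \<sigma> \<tau> x @ [if p then opp t else t]" for x
  proof (cases x)
    case Nil
    have "glue \<sigma> \<tau> [t] = [t]" for t
      by (cases t) (simp_all add: tree_auts_root[OF assms(1)] tree_auts_root[OF assms(2)])
    with Nil show ?thesis
      by (intro exI[of _ False]) simp
  next
    case (Cons s y)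
    then show ?thesis
      using tree_auts_UNIV_step[OF assms(1), of y] tree_auts_UNIV_step[OF assms(2), of y]
      by (cases s) auto
  qed
qed simp

lemma Par_glue:
  "\<sigma> [] = [] \<Longrightarrow> \<tau> [] = [] \<Longrightarrow> Par (glue \<sigma> \<tau>) [] = 0"
  "Par (glue \<sigma> \<tau>) (La # x) = Par \<sigma> x"
  "Par (glue \<sigma> \<tau>) (Lb # x) = Par \<tau> x"
  by (simp_all add: Par_def)

lemma Q_inv_glue:
  "Q_inv (glue \<sigma> \<tau>) (La # x) = Q_inv \<sigma> x"
  "Q_inv (glue \<sigma> \<tau>) (Lb # x) = Q_inv \<tau> x"
  by (simp_all add: Q_inv_def Par_glue)

lemma glue_comp: "glue \<sigma> \<tau> \<circ> glue \<sigma>' \<tau>' = glue (\<sigma> \<circ> \<sigma>') (\<tau> \<circ> \<tau>')"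
proof
  fix w
  show "(glue \<sigma> \<tau> \<circ> glue \<sigma>' \<tau>') w = glue (\<sigma> \<circ> \<sigma>') (\<tau> \<circ> \<tau>') w"
    by (cases "(\<sigma>, \<tau>, w)" rule: glue.cases) auto
qed

lemma glue_id: "glue id id = id"
proof
  fix w
  show "glue id id w = id w"
    by (cases "(id :: node \<Rightarrow> node, id :: node \<Rightarrow> node, w)" rule: glue.cases) auto
qed

lemma glue_sec:
  assumes \<sigma>: "\<sigma> \<in> tree_auts UNIV" and "Par \<sigma> [] = 0"
  shows "glue (sec La \<sigma>) (sec Lb \<sigma>) = \<sigma>"
proof
  fix w
  show "glue (sec La \<sigma>) (sec Lb \<sigma>) w = \<sigma> w"
    by (cases "(\<sigma>, \<sigma>, w)" rule: glue.cases)
      (simp_all add: tree_auts_Cons[OF \<sigma>] tree_auts_root[OF \<sigma>] assms(2))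
qed

section \<open>The cocycle property of \<open>Q\<close>\<close>

text \<open>At the root this is the \<phi> of the introduction. Being symmetric in the two children,
  it is insensitive to a swap of them.\<close>

definition Qsum :: "(node \<Rightarrow> node) \<Rightarrow> node \<Rightarrow> two_adic" where
  "Qsum \<sigma> x = Q_inv \<sigma> (x @ [La]) + Q_inv \<sigma> (x @ [Lb])"

text \<open>Equality of the images in Aut(T_n); for automorphisms of the infinite tree, congruence
  modulo \<open>U_lev n\<close>.\<close>

definition agree :: "nat \<Rightarrow> (node \<Rightarrow> node) \<Rightarrow> (node \<Rightarrow> node) \<Rightarrow> bool" where
  "agree n \<sigma> \<tau> \<longleftrightarrow> (\<forall>w. length w \<le> n \<longrightarrow> \<sigma> w = \<tau> w)"

text \<open>
  For \<open>length x + 2 * k < n\<close>, the class of \<open>P(\<sigma>, x)\<close> modulo \<open>2\<^bsup>k+1\<^esup>\<close> depends only on the restriction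
  of \<open>\<sigma>\<close> to \<open>T\<^sub>n\<close>.
\<close>

definition good :: "nat \<Rightarrow> (node \<Rightarrow> node) \<Rightarrow> bool" where
  "good n \<sigma> \<longleftrightarrow> (\<forall>x k. length x + 2 * k < n \<longrightarrow> 2 ^ Suc k dvd P_inv \<sigma> x - 1)"

lemma Q_inv_eq: "Q_inv \<sigma> x = of_nat (Par \<sigma> x) + 2 * Qsum \<sigma> (x @ [La])"
  by (simp add: Q_inv_rec[of \<sigma> x] Qsum_def)

text \<open>Since (-1)^p = 1 - 2p for p in {0,1}, the equation P = 1 turns into a linear relation
  between \<open>Qsum\<close> and \<open>Par\<close>. Knowing this relation modulo 2^k amounts to
  knowing P = 1 modulo 2^(k+1).\<close>

lemma P_inv_eq:
  "P_inv \<sigma> x - 1 = 2 * (Qsum \<sigma> (x @ [Lb]) - Qsum \<sigma> (x @ [La]) - of_nat (Par \<sigma> x))"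
  using Par_cases[of \<sigma> x] by (auto simp: P_inv_def Qsum_def algebra_simps)

lemma good_iff:
  "good n \<sigma> \<longleftrightarrow> (\<forall>x k. length x + 2 * k < n \<longrightarrow>
     2 ^ k dvd Qsum \<sigma> (x @ [Lb]) - Qsum \<sigma> (x @ [La]) - of_nat (Par \<sigma> x))"
  unfolding good_def P_inv_eq two_power_dvd_double_iff ..

lemma goodD:
  "good n \<sigma> \<Longrightarrow> length x + 2 * k < n \<Longrightarrow>
     2 ^ k dvd Qsum \<sigma> (x @ [Lb]) - Qsum \<sigma> (x @ [La]) - of_nat (Par \<sigma> x)"
  unfolding good_iff by blast

lemma good_mono: "good n \<sigma> \<Longrightarrow> m \<le> n \<Longrightarrow> good m \<sigma>"
  unfolding good_def by (meson order_less_le_trans)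

lemma Qsum_image:
  assumes \<tau>: "\<tau> \<in> tree_auts UNIV"
  shows "Q_inv \<sigma> (\<tau> (y @ [La])) + Q_inv \<sigma> (\<tau> (y @ [Lb])) = Qsum \<sigma> (\<tau> y)"
  by (simp add: tree_auts_snoc[OF \<tau>] Qsum_def)

text \<open>If \<tau> keeps the children of x, the error at x is twice the error d two levels down.
  If it swaps them, the image of xa ends in b, and passing from b back to a, together with the carry
  in the sum of the parities, costs exactly e, which goodness of \<sigma> makes divisible by
  2^k.\<close>

lemma Q_inv_comp:
  assumes \<sigma>: "\<sigma> \<in> tree_auts UNIV" and \<tau>: "\<tau> \<in> tree_auts UNIV" and good: "good n \<sigma>"
  shows "length x + 2 * k \<le> Suc n \<Longrightarrow> 2 ^ k dvd Q_inv (\<sigma> \<circ> \<tau>) x - Q_inv \<sigma> (\<tau> x) - Q_inv \<tau> x"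
proof (induction k arbitrary: x)
  case (Suc k)
  define d where "d = Qsum (\<sigma> \<circ> \<tau>) (x @ [La]) - Qsum \<sigma> (\<tau> (x @ [La])) - Qsum \<tau> (x @ [La])"
  define e where
    "e = Qsum \<sigma> (\<tau> x @ [Lb]) - Qsum \<sigma> (\<tau> x @ [La]) - of_nat (Par \<sigma> (\<tau> x))"
  have "2 ^ k dvd (Q_inv (\<sigma> \<circ> \<tau>) (x @ [La] @ [t]) - Q_inv \<sigma> (\<tau> (x @ [La] @ [t]))
      - Q_inv \<tau> (x @ [La] @ [t]))" for t
    using Suc.prems by (intro Suc.IH) simp
  from dvd_add[OF this[of La] this[of Lb]] have d: "2 ^ k dvd d"
    unfolding d_def Qsum_image[OF \<tau>, symmetric] by (simp add: Qsum_def algebra_simps)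
  have e: "2 ^ k dvd e"
    unfolding e_def by (rule goodD[OF good]) (use Suc.prems in \<open>simp add: tree_auts_length[OF \<tau>]\<close>)
  have "Q_inv (\<sigma> \<circ> \<tau>) x - Q_inv \<sigma> (\<tau> x) - Q_inv \<tau> x = 2 * (if Par \<tau> x = 0 then d else d + e)"
    using Par_cases[of \<tau> x] Par_cases[of \<sigma> "\<tau> x"]
    by (auto simp: Q_inv_eq[of _ x] Q_inv_eq[of _ "\<tau> x"] Par_comp[OF \<sigma> \<tau>] d_def e_def
        tree_auts_snoc[OF \<tau>] algebra_simps)
  then show ?case
    using d e by (simp only: two_power_dvd_double_iff) simp
qed simp

lemma Qsum_comp:
  assumes "\<sigma> \<in> tree_auts UNIV" and \<tau>: "\<tau> \<in> tree_auts UNIV" and "good n \<sigma>"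
    and "length x + 2 * k \<le> n"
  shows "2 ^ k dvd Qsum (\<sigma> \<circ> \<tau>) x - Qsum \<sigma> (\<tau> x) - Qsum \<tau> x"
proof -
  have "2 ^ k dvd Q_inv (\<sigma> \<circ> \<tau>) (x @ [t]) - Q_inv \<sigma> (\<tau> (x @ [t])) - Q_inv \<tau> (x @ [t])" for t
    using assms by (intro Q_inv_comp) simp_all
  from dvd_add[OF this[of La] this[of Lb]] show ?thesis
    unfolding Qsum_image[OF \<tau>, symmetric] by (simp add: Qsum_def algebra_simps)
qed

text \<open>A good left factor does not change P to the visible precision. The errors d come from
  the cocycle property of \<open>Qsum\<close>, while a swap by \<tau> at x merely reverses the sign
  of e.\<close>

lemma P_inv_comp:
  assumes \<sigma>: "\<sigma> \<in> tree_auts UNIV" and \<tau>: "\<tau> \<in> tree_auts UNIV" and good: "good n \<sigma>"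
    and len: "length x + 2 * k < n"
  shows "2 ^ Suc k dvd P_inv (\<sigma> \<circ> \<tau>) x - P_inv \<tau> x"
proof -
  define d where "d s = Qsum (\<sigma> \<circ> \<tau>) (x @ [s]) - Qsum \<sigma> (\<tau> (x @ [s])) - Qsum \<tau> (x @ [s])" for s
  define e where
    "e = Qsum \<sigma> (\<tau> x @ [Lb]) - Qsum \<sigma> (\<tau> x @ [La]) - of_nat (Par \<sigma> (\<tau> x))"
  have d: "2 ^ k dvd d s" for s
    unfolding d_def using len by (intro Qsum_comp[OF \<sigma> \<tau> good]) simp
  have e: "2 ^ k dvd e"
    unfolding e_def by (rule goodD[OF good]) (use len in \<open>simp add: tree_auts_length[OF \<tau>]\<close>)
  have "P_inv (\<sigma> \<circ> \<tau>) x - P_inv \<tau> x = (P_inv (\<sigma> \<circ> \<tau>) x - 1) - (P_inv \<tau> x - 1)"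
    by simp
  also have "\<dots> = 2 * (if Par \<tau> x = 0 then d Lb - d La + e else d Lb - d La - e)"
    unfolding P_inv_eq using Par_cases[of \<tau> x] Par_cases[of \<sigma> "\<tau> x"]
    by (auto simp: Par_comp[OF \<sigma> \<tau>] d_def e_def tree_auts_snoc[OF \<tau>] algebra_simps)
  finally show ?thesis
    using d e by (simp only: two_power_dvd_double_iff) simp
qed

text \<open>The equivalence yields closure under products, cancellation of a good left factor, and
  (applied to \<sigma> and its inverse) closure under inverses.\<close>

lemma good_comp_iff:
  assumes "\<sigma> \<in> tree_auts UNIV" "\<tau> \<in> tree_auts UNIV" "good n \<sigma>"
  shows "good n (\<sigma> \<circ> \<tau>) \<longleftrightarrow> good n \<tau>"
proof -
  have "2 ^ Suc k dvd P_inv (\<sigma> \<circ> \<tau>) x - 1 \<longleftrightarrow> 2 ^ Suc k dvd P_inv \<tau> x - 1"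
    if "length x + 2 * k < n" for x k
  proof -
    have "P_inv (\<sigma> \<circ> \<tau>) x - 1 = (P_inv (\<sigma> \<circ> \<tau>) x - P_inv \<tau> x) + (P_inv \<tau> x - 1)"
      by simp
    then show ?thesis
      using P_inv_comp[OF assms that] dvd_add_right_iff by metis
  qed
  then show ?thesis
    unfolding good_def by blast
qed

section \<open>The identity, inverses, and dependence on finitely many levels\<close>

lemma Par_id [simp]: "Par id x = 0"
  by (simp add: Par_def)

lemma Q_inv_id [simp]: "Q_inv id x = 0"
  by (simp add: Q_inv_def)

lemma Qsum_id [simp]: "Qsum id x = 0"
  by (simp add: Qsum_def)

lemma good_id: "good n id"
  by (simp add: good_iff)

lemma comp_inv: "\<sigma> \<in> tree_auts UNIV \<Longrightarrow> \<sigma> \<circ> inv_into UNIV \<sigma> = id"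
  using tree_auts_bij[of \<sigma>] by (simp add: bij_def surj_iff)

lemma inv_comp: "\<sigma> \<in> tree_auts UNIV \<Longrightarrow> inv_into UNIV \<sigma> \<circ> \<sigma> = id"
  using tree_auts_bij[of \<sigma>] by (simp add: bij_def)

lemma good_inv:
  assumes \<sigma>: "\<sigma> \<in> tree_auts UNIV" and "good n \<sigma>"
  shows "good n (inv_into UNIV \<sigma>)"
  using good_comp_iff[OF \<sigma> tree_auts_inv[OF \<sigma>], of n] assms by (simp add: comp_inv good_id)

lemma agree_Par: "agree n \<sigma> \<tau> \<Longrightarrow> length x < n \<Longrightarrow> Par \<sigma> x = Par \<tau> x"
  unfolding agree_def Par_def by simp

text \<open>For positive k, the deepest parities that matter modulo 2^k sit at level
  \<open>length x + 2 * (k - 1)\<close>, and the length condition says that this is below n.\<close>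

lemma agree_Q_inv:
  assumes "agree n \<sigma> \<tau>"
  shows "length x + 2 * k \<le> Suc n \<Longrightarrow> 2 ^ k dvd Q_inv \<sigma> x - Q_inv \<tau> x"
proof (induction k arbitrary: x)
  case (Suc k)
  have "2 ^ k dvd Q_inv \<sigma> (x @ [La, t]) - Q_inv \<tau> (x @ [La, t])" for t
    using Suc.prems by (intro Suc.IH) simp
  from dvd_add[OF this[of La] this[of Lb]]
  have "2 ^ k dvd Qsum \<sigma> (x @ [La]) - Qsum \<tau> (x @ [La])"
    by (simp add: Qsum_def algebra_simps)
  moreover have "Q_inv \<sigma> x - Q_inv \<tau> x = 2 * (Qsum \<sigma> (x @ [La]) - Qsum \<tau> (x @ [La]))"
    using Suc.prems by (simp add: Q_inv_eq[of _ x] agree_Par[OF assms] algebra_simps)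
  ultimately show ?case
    by (simp only: two_power_dvd_double_iff)
qed simp

lemma agree_Qsum:
  assumes "agree n \<sigma> \<tau>" "length x + 2 * k \<le> n"
  shows "2 ^ k dvd Qsum \<sigma> x - Qsum \<tau> x"
proof -
  have "2 ^ k dvd Q_inv \<sigma> (x @ [t]) - Q_inv \<tau> (x @ [t])" for t
    using assms by (intro agree_Q_inv) simp_all
  from dvd_add[OF this[of La] this[of Lb]] show ?thesis
    by (simp add: Qsum_def algebra_simps)
qed

lemma agree_P_inv:
  assumes "agree n \<sigma> \<tau>" "length x + 2 * k < n"
  shows "2 ^ Suc k dvd P_inv \<sigma> x - P_inv \<tau> x"
proof -
  have "2 ^ k dvd Qsum \<sigma> (x @ [s]) - Qsum \<tau> (x @ [s])" for s
    using assms by (intro agree_Qsum) (simp_all add: Suc_le_eq)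
  from dvd_diff[OF this[of Lb] this[of La]]
  have "2 ^ Suc k dvd 2 * (Qsum \<sigma> (x @ [Lb]) - Qsum \<sigma> (x @ [La]) - of_nat (Par \<sigma> x))
      - 2 * (Qsum \<tau> (x @ [Lb]) - Qsum \<tau> (x @ [La]) - of_nat (Par \<tau> x))"
    unfolding right_diff_distrib[symmetric, of "2 :: two_adic"] two_power_dvd_double_iff
    using assms by (simp add: agree_Par[OF assms(1)] algebra_simps)
  then show ?thesis
    unfolding P_inv_eq[symmetric] by simp
qed

lemma good_agree:
  assumes "agree n \<sigma> \<tau>" "good n \<sigma>"
  shows "good n \<tau>"
  unfolding good_def
proof (intro allI impI)
  fix x :: node and k
  assume len: "length x + 2 * k < n"
  then have "2 ^ Suc k dvd P_inv \<sigma> x - 1"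
    using assms(2) unfolding good_def by blast
  from dvd_diff[OF this agree_P_inv[OF assms(1) len]] show "2 ^ Suc k dvd P_inv \<tau> x - 1"
    by simp
qed

text \<open>Nodes other than the root are nodes of a section, with one level less visible; the root
  itself contributes a single congruence.\<close>

lemma good_Suc_iff:
  assumes \<sigma>: "\<sigma> \<in> tree_auts UNIV"
  shows "good (Suc n) \<sigma> \<longleftrightarrow> good n (sec La \<sigma>) \<and> good n (sec Lb \<sigma>) \<and>
    2 ^ (n div 2) dvd Qsum (sec Lb \<sigma>) [] - Qsum (sec La \<sigma>) [] - of_nat (Par \<sigma> [])"
    (is "_ \<longleftrightarrow> _ \<and> _ \<and> _ dvd ?d")
proof -
  have root: "2 ^ Suc k dvd P_inv \<sigma> [] - 1 \<longleftrightarrow> 2 ^ k dvd ?d" for k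
    unfolding P_inv_eq two_power_dvd_double_iff by (simp add: Qsum_def Q_inv_sec[OF \<sigma>])
  have "good (Suc n) \<sigma> \<longleftrightarrow> (\<forall>k. 2 * k < Suc n \<longrightarrow> 2 ^ Suc k dvd P_inv \<sigma> [] - 1) \<and>
      (\<forall>s x k. Suc (length x) + 2 * k < Suc n \<longrightarrow> 2 ^ Suc k dvd P_inv \<sigma> (s # x) - 1)"
    unfolding good_def by (metis add_0 length_Cons list.exhaust list.size(3))
  also have "\<dots> \<longleftrightarrow> 2 ^ (n div 2) dvd ?d \<and> (\<forall>s. good n (sec s \<sigma>))"
  proof -
    \<comment> \<open>Among the congruences at the root the one with the largest exponent,
      \<open>n div 2\<close>, implies all others.\<close>
    have "2 ^ k dvd ?d" if "2 ^ (n div 2) dvd ?d" "2 * k < Suc n" for k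
      using that by (intro dvd_trans[OF le_imp_power_dvd that(1)]) simp
    moreover have "2 * (n div 2) < Suc n"
      by simp
    ultimately show ?thesis
      unfolding root good_def P_inv_sec[OF \<sigma>] by auto
  qed
  finally show ?thesis
    by (auto simp: all_letter)
qed

lemma good_glue_iff:
  assumes \<sigma>: "\<sigma> \<in> tree_auts UNIV" and \<tau>: "\<tau> \<in> tree_auts UNIV"
  shows "good (Suc n) (glue \<sigma> \<tau>) \<longleftrightarrow> good n \<sigma> \<and> good n \<tau> \<and> 2 ^ (n div 2) dvd Qsum \<tau> [] - Qsum \<sigma> []"
proof -
  have "sec La (glue \<sigma> \<tau>) = \<sigma>" "sec Lb (glue \<sigma> \<tau>) = \<tau>"
    by (simp_all add: sec_def fun_eq_iff)
  then show ?thesis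
    by (simp add: good_Suc_iff[OF glue_tree_auts[OF \<sigma> \<tau>]] Par_glue tree_auts_root[OF \<sigma>] tree_auts_root[OF \<tau>])
qed

section \<open>The basilica group\<close>

lemma carrier_Aut_inf: "carrier Aut_inf = tree_auts UNIV"
  by (simp add: Aut_inf_def)

lemma mult_Aut_inf:
  assumes "\<sigma> \<in> tree_auts UNIV" "\<tau> \<in> tree_auts UNIV"
  shows "\<sigma> \<otimes>\<^bsub>Aut_inf\<^esub> \<tau> = \<sigma> \<circ> \<tau>"
  using assms by (auto simp: Aut_inf_def BijGroup_def tree_auts_def compose_def)

lemma one_Aut_inf: "\<one>\<^bsub>Aut_inf\<^esub> = id"
  by (auto simp: Aut_inf_def BijGroup_def)

lemma group_Aut_inf: "group Aut_inf"
proof (rule groupI)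
  fix \<sigma> assume "\<sigma> \<in> carrier Aut_inf"
  then show "\<exists>\<tau>\<in>carrier Aut_inf. \<tau> \<otimes>\<^bsub>Aut_inf\<^esub> \<sigma> = \<one>\<^bsub>Aut_inf\<^esub>"
    unfolding carrier_Aut_inf one_Aut_inf
    by (intro bexI[of _ "inv_into UNIV \<sigma>"]) (simp_all add: mult_Aut_inf tree_auts_inv inv_comp)
qed (simp_all add: carrier_Aut_inf mult_Aut_inf one_Aut_inf tree_auts_comp tree_auts_id comp_assoc)

lemma inv_Aut_inf:
  assumes \<sigma>: "\<sigma> \<in> tree_auts UNIV"
  shows "inv\<^bsub>Aut_inf\<^esub> \<sigma> = inv_into UNIV \<sigma>"
  using assms by (intro group.inv_equality[OF group_Aut_inf])
    (simp_all add: carrier_Aut_inf mult_Aut_inf one_Aut_inf tree_auts_inv inv_comp)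

text \<open>Wreath recursion for the generators: \<open>alpha\<close> swaps the two subtrees, with
  sections 1 at a and \<open>beta\<close> at b; \<open>beta\<close> is (1, \<open>alpha\<close>).
  These concrete functions replace the definite descriptions once their parities have been
  compared.\<close>

fun alpha beta :: "node \<Rightarrow> node" where
  "alpha [] = []"
| "alpha (La # w) = Lb # w"
| "alpha (Lb # w) = La # beta w"
| "beta [] = []"
| "beta (La # w) = La # w"
| "beta (Lb # w) = Lb # alpha w"

lemma beta_eq_glue: "beta = glue id alpha"
proof
  fix w
  show "beta w = glue id alpha w"
    by (cases "(alpha, beta, w)" rule: glue.cases) auto
qed

lemma alpha_beta_step:
  "(\<exists>p. \<forall>s. alpha (x @ [s]) = alpha x @ [if p then opp s else s]) \<and>
   (\<exists>p. \<forall>s. beta (x @ [s]) = beta x @ [if p then opp s else s])"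
proof (induction x)
  case Nil
  then show ?case
    by (auto simp: all_letter intro: exI[of _ True] exI[of _ False])
next
  case (Cons t x)
  have "\<exists>p. \<forall>s. x @ [s] = x @ [if p then opp s else s]"
    by (rule exI[of _ False]) simp
  with Cons show ?case
    by (cases t) auto
qed

lemma alpha_tree_auts: "alpha \<in> tree_auts UNIV"
  and beta_tree_auts: "beta \<in> tree_auts UNIV"
  using alpha_beta_step by (intro step_tree_auts; simp)+

lemma ex_replicate_iff: "(\<exists>k. R k \<and> y = replicate k s) \<longleftrightarrow> R (length y) \<and> set y \<subseteq> {s}"
  using replicate_eqI[of y "length y" s] by auto

lemma Par_alpha_beta:
  "Par alpha y = (if \<exists>k. even k \<and> y = replicate k Lb then 1 else 0) \<and>
   Par beta y = (if \<exists>k. odd k \<and> y = replicate k Lb then 1 else 0)"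
  unfolding ex_replicate_iff
proof (induction y)
  case Nil
  show ?case
    by (simp add: Par_def)
next
  case (Cons s y)
  have "Par alpha (La # y) = 0" "Par beta (La # y) = 0"
    "Par alpha (Lb # y) = Par beta y" "Par beta (Lb # y) = Par alpha y"
    by (simp_all add: Par_def)
  with Cons show ?case
    by (cases s) simp_all
qed

lemma basilica_\<alpha>_eq: "basilica_\<alpha> = alpha"
  unfolding basilica_\<alpha>_def using Par_alpha_beta
  by (intro the_equality conjI alpha_tree_auts allI)
    (auto intro!: tree_auts_eqI alpha_tree_auts)

lemma basilica_\<beta>_eq: "basilica_\<beta> = beta"
  unfolding basilica_\<beta>_def using Par_alpha_beta
  by (intro the_equality conjI beta_tree_auts allI)
    (auto intro!: tree_auts_eqI beta_tree_auts)

lemma alpha_squared: "alpha \<circ> alpha = glue beta beta"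
proof
  fix w
  show "(alpha \<circ> alpha) w = glue beta beta w"
    by (cases "(alpha, beta, w)" rule: glue.cases) auto
qed

text \<open>Conjugation by \<open>alpha\<close> carries the coordinate at b to the one at a,
  unaltered because the section of \<open>alpha\<close> at a is trivial. This turns 1 x R into R x
  1.\<close>

lemma alpha_conj_glue:
  "inv_into UNIV alpha \<circ> glue id \<sigma> \<circ> alpha = glue \<sigma> id"
proof -
  have "glue id \<sigma> (alpha w) = alpha (glue \<sigma> id w)" for w
    by (cases "(alpha, beta, w)" rule: glue.cases) auto
  then have "glue id \<sigma> \<circ> alpha = alpha \<circ> glue \<sigma> id"
    by auto
  then show ?thesis
    using inv_comp[OF alpha_tree_auts] by (simp add: comp_assoc) (simp flip: comp_assoc)
qed

lemma sec_alpha: "sec La alpha = id" "sec Lb alpha = beta"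
  by (simp_all add: sec_def fun_eq_iff)

lemma Par_alpha_root: "Par alpha [] = 1"
  by (simp add: Par_def)

lemma Qsum_alpha: "Qsum alpha [] = 0"
  and Qsum_beta: "Qsum beta [] = 1"
proof -
  have a: "Q_inv alpha (La # x) = 0" "Q_inv alpha (Lb # x) = Q_inv beta x" for x
    using Q_inv_sec[OF alpha_tree_auts] sec_alpha by (metis Q_inv_id)+
  have b: "Q_inv beta (La # x) = 0" "Q_inv beta (Lb # x) = Q_inv alpha x" for x
    unfolding beta_eq_glue Q_inv_glue by simp_all
  \<comment> \<open>The recursion at the root only looks below a, where both generators have trivial
    sections, so Q reduces to the parity of the root.\<close>
  have "Q_inv alpha [] = 1" "Q_inv beta [] = 0"
    by (simp_all add: Q_inv_rec[of _ "[]"] a b Par_alpha_root) (simp add: Par_def)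
  then show "Qsum alpha [] = 0" "Qsum beta [] = 1"
    by (simp_all add: Qsum_def a b)
qed

text \<open>The induction is simultaneous because the nontrivial section of each generator is the
  other one. The congruences at the root even hold exactly: 1 - 0 - 1 = 0 for \<open>alpha\<close>
  and 0 - 0 = 0 for \<open>beta\<close>.\<close>

lemma good_alpha_beta: "good n alpha \<and> good n beta"
proof (induction n)
  case 0
  then show ?case
    by (simp add: good_def)
next
  case (Suc n)
  have "good (Suc n) alpha"
    using Suc by (simp add: good_Suc_iff[OF alpha_tree_auts] sec_alpha good_id Qsum_beta Par_alpha_root)
  moreover have "good (Suc n) beta"
    unfolding beta_eq_glue using Suc
    by (simp add: good_glue_iff[OF tree_auts_id alpha_tree_auts] good_id Qsum_alpha)
  ultimately show ?case ..
qed

lemmas good_alpha = good_alpha_beta[THEN conjunct1]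
lemmas good_beta = good_alpha_beta[THEN conjunct2]

section \<open>Closure properties of the basilica group, and goodness of its elements\<close>

lemma B_inf_eq: "B_inf = generate Aut_inf {alpha, beta}"
  by (simp add: B_inf_def basilica_\<alpha>_eq basilica_\<beta>_eq)

lemma B_inf_tree_auts: "\<sigma> \<in> B_inf \<Longrightarrow> \<sigma> \<in> tree_auts UNIV"
  using group.generate_in_carrier[OF group_Aut_inf, of "{alpha, beta}" \<sigma>]
  by (simp add: B_inf_eq carrier_Aut_inf alpha_tree_auts beta_tree_auts)

lemma B_inf_alpha: "alpha \<in> B_inf" and B_inf_beta: "beta \<in> B_inf"
  by (simp_all add: B_inf_eq generate.incl)

lemma B_inf_id: "id \<in> B_inf"
  using generate.one[of Aut_inf] by (simp add: B_inf_eq one_Aut_inf)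

lemma B_inf_comp: "\<sigma> \<in> B_inf \<Longrightarrow> \<tau> \<in> B_inf \<Longrightarrow> \<sigma> \<circ> \<tau> \<in> B_inf"
  using generate.eng[of \<sigma> Aut_inf "{alpha, beta}" \<tau>] B_inf_tree_auts mult_Aut_inf
  by (simp add: B_inf_eq)

lemma B_inf_inv:
  assumes "\<sigma> \<in> B_inf"
  shows "inv_into UNIV \<sigma> \<in> B_inf"
  using group.generate_m_inv_closed[OF group_Aut_inf, of "{alpha, beta}" \<sigma>]
    inv_Aut_inf[OF B_inf_tree_auts[OF assms]] assms
  by (simp add: B_inf_eq carrier_Aut_inf alpha_tree_auts beta_tree_auts)

lemma B_inf_induct [consumes 1, case_names id alpha beta inv_alpha inv_beta comp]:
  assumes \<sigma>: "\<sigma> \<in> B_inf"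
    and "R id" "R alpha" "R beta" "R (inv_into UNIV alpha)" "R (inv_into UNIV beta)"
    and comp: "\<And>\<sigma> \<tau>. \<sigma> \<in> B_inf \<Longrightarrow> \<tau> \<in> B_inf \<Longrightarrow> R \<sigma> \<Longrightarrow> R \<tau> \<Longrightarrow> R (\<sigma> \<circ> \<tau>)"
  shows "R \<sigma>"
  using \<sigma> unfolding B_inf_eq
proof (induction rule: generate.induct)
  case one
  then show ?case
    unfolding one_Aut_inf by (rule assms)
next
  case (incl h)
  then show ?case
    using assms by auto
next
  case (inv h)
  then show ?case
    using assms by (auto simp: inv_Aut_inf alpha_tree_auts beta_tree_auts)
next
  case (eng \<sigma> \<tau>)
  then show ?case
    using comp[of \<sigma> \<tau>] mult_Aut_inf[of \<sigma> \<tau>] B_inf_tree_auts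
    unfolding B_inf_eq by metis
qed

lemma good_B_inf: "\<sigma> \<in> B_inf \<Longrightarrow> good n \<sigma>"
proof (induction rule: B_inf_induct)
  case (comp \<sigma> \<tau>)
  then show ?case
    using good_comp_iff[of \<sigma> \<tau> n] B_inf_tree_auts by blast
qed (rule good_id good_alpha good_beta good_inv alpha_tree_auts beta_tree_auts)+

section \<open>Approximation by elements of the basilica group\<close>

lemma agree_refl: "agree n \<sigma> \<sigma>"
  by (simp add: agree_def)

lemma agree_sym: "agree n \<sigma> \<tau> \<Longrightarrow> agree n \<tau> \<sigma>"
  by (simp add: agree_def)

lemma agree_trans: "agree n \<sigma> \<tau> \<Longrightarrow> agree n \<tau> \<rho> \<Longrightarrow> agree n \<sigma> \<rho>"
  by (simp add: agree_def)

lemma agree_comp: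
  assumes "agree n \<sigma> \<sigma>'" "agree n \<tau> \<tau>'" and \<tau>: "\<tau> \<in> tree_auts UNIV"
  shows "agree n (\<sigma> \<circ> \<tau>) (\<sigma>' \<circ> \<tau>')"
  using assms(1,2) tree_auts_length[OF \<tau>] unfolding agree_def by (metis comp_apply)

lemma agree_glue:
  assumes "agree n \<sigma> \<sigma>'" "agree n \<tau> \<tau>'"
  shows "agree (Suc n) (glue \<sigma> \<tau>) (glue \<sigma>' \<tau>')"
  unfolding agree_def
proof (intro allI impI)
  fix w :: node
  assume "length w \<le> Suc n"
  then show "glue \<sigma> \<tau> w = glue \<sigma>' \<tau>' w"
    using assms by (cases "(\<sigma>, \<tau>, w)" rule: glue.cases) (auto simp: agree_def)
qed

lemma inv_comp_cancel: "\<sigma> \<in> tree_auts UNIV \<Longrightarrow> inv_into UNIV \<sigma> \<circ> (\<sigma> \<circ> \<tau>) = \<tau>"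
  by (metis comp_assoc fun.map_id inv_comp)

lemma comp_inv_cancel: "\<sigma> \<in> tree_auts UNIV \<Longrightarrow> \<sigma> \<circ> (inv_into UNIV \<sigma> \<circ> \<tau>) = \<tau>"
  by (metis comp_assoc fun.map_id comp_inv)

lemma inv_glue:
  assumes \<sigma>: "\<sigma> \<in> tree_auts UNIV" and \<tau>: "\<tau> \<in> tree_auts UNIV"
  shows "inv_into UNIV (glue \<sigma> \<tau>) = glue (inv_into UNIV \<sigma>) (inv_into UNIV \<tau>)"
  by (rule inv_unique_comp)
    (simp_all only: glue_comp comp_inv[OF \<sigma>] comp_inv[OF \<tau>] inv_comp[OF \<sigma>] inv_comp[OF \<tau>] glue_id)

section \<open>Powers of the generators\<close>

lemma funpow_tree_auts: "\<sigma> \<in> tree_auts UNIV \<Longrightarrow> \<sigma> ^^ m \<in> tree_auts UNIV"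
  by (induction m) (simp_all only: funpow.simps tree_auts_id tree_auts_comp)

lemma good_funpow:
  assumes "\<sigma> \<in> tree_auts UNIV" "good n \<sigma>"
  shows "good n (\<sigma> ^^ m)"
proof (induction m)
  case 0
  then show ?case
    unfolding funpow.simps by (rule good_id)
next
  case (Suc m)
  then show ?case
    unfolding funpow.simps using good_comp_iff[OF assms(1) funpow_tree_auts assms(2)] assms by blast
qed

lemma agree_id_funpow:
  assumes "agree n \<sigma> id" "\<sigma> \<in> tree_auts UNIV"
  shows "agree n (\<sigma> ^^ m) id"
proof (induction m)
  case (Suc m)
  from agree_comp[OF assms(1) this funpow_tree_auts[OF assms(2)]] show ?case
    by (simp only: funpow.simps id_comp)
qed (simp only: funpow.simps agree_refl)

lemma Qsum_comp_eq:
  assumes "\<sigma> \<in> tree_auts UNIV" "\<tau> \<in> tree_auts UNIV" "\<And>n. good n \<sigma>"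
  shows "Qsum (\<sigma> \<circ> \<tau>) [] = Qsum \<sigma> [] + Qsum \<tau> []"
proof (rule two_adic_eq_if_dvd)
  show "2 ^ k dvd Qsum (\<sigma> \<circ> \<tau>) [] - (Qsum \<sigma> [] + Qsum \<tau> [])" for k
    using Qsum_comp[OF assms(1,2) assms(3)[of "2 * k"], of "[]" k]
    by (simp add: tree_auts_root[OF assms(2)] diff_diff_eq)
qed

lemma Qsum_beta_power: "Qsum (beta ^^ m) [] = of_nat m"
proof (induction m)
  case 0
  then show ?case
    by (simp only: funpow.simps Qsum_id of_nat_0)
next
  case (Suc m)
  then show ?case
    using Qsum_comp_eq[OF beta_tree_auts funpow_tree_auts[OF beta_tree_auts, of m] good_beta]
    by (simp only: funpow.simps Qsum_beta of_nat_Suc)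
qed

lemma Qsum_beta_power_comp:
  assumes "\<sigma> \<in> tree_auts UNIV"
  shows "Qsum (beta ^^ m \<circ> \<sigma>) [] = of_nat m + Qsum \<sigma> []"
  using Qsum_comp_eq[OF funpow_tree_auts[OF beta_tree_auts] assms good_funpow[OF beta_tree_auts good_beta]]
  by (simp only: Qsum_beta_power)

lemma glue_funpow: "glue \<sigma> \<tau> ^^ m = glue (\<sigma> ^^ m) (\<tau> ^^ m)"
  by (induction m) (simp_all only: funpow.simps glue_comp glue_id)

lemma id_power: "(id :: 'a \<Rightarrow> 'a) ^^ m = id"
  by (induction m) simp_all

lemma alpha_power: "alpha ^^ (2 * m) = glue (beta ^^ m) (beta ^^ m)"
proof -
  have "alpha ^^ 2 = glue beta beta"
    by (simp only: numeral_2_eq_2 funpow.simps comp_id alpha_squared)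
  then show ?thesis
    by (simp only: funpow_mult[symmetric] glue_funpow)
qed

lemma beta_power: "beta ^^ m = glue id (alpha ^^ m)"
  by (simp only: beta_eq_glue glue_funpow id_power)

text \<open>Both \<open>alpha_power\<close> and \<open>beta_power\<close> pass one level down, but
  only the former halves the exponent. So two levels cost one factor 2, with the ceiling of n/2 for
  \<open>alpha\<close> and the floor for \<open>beta\<close>.\<close>

lemma alpha_beta_order:
  "agree n (alpha ^^ 2 ^ (Suc n div 2)) id \<and> agree n (beta ^^ 2 ^ (n div 2)) id"
proof (induction n)
  case 0
  then show ?case
    by (simp add: agree_def)
next
  case (Suc n)
  have "agree (Suc n) (glue (beta ^^ 2 ^ (n div 2)) (beta ^^ 2 ^ (n div 2))) (glue id id)"
    using Suc by (blast intro: agree_glue)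
  moreover have "agree (Suc n) (glue id (alpha ^^ 2 ^ (Suc n div 2))) (glue id id)"
    using Suc by (blast intro: agree_glue agree_refl)
  moreover have "(2 :: nat) ^ (Suc (Suc n) div 2) = 2 * 2 ^ (n div 2)"
    by simp
  ultimately show ?case
    by (simp only: alpha_power beta_power[of "2 ^ (Suc n div 2)"] glue_id)
qed

text \<open>The group \<open>R\<close> of the introduction.\<close>

definition right_kernel :: "(node \<Rightarrow> node) set" where
  "right_kernel = {\<sigma> \<in> tree_auts UNIV. glue id \<sigma> \<in> B_inf}"

lemma right_kernel_tree_auts: "\<sigma> \<in> right_kernel \<Longrightarrow> \<sigma> \<in> tree_auts UNIV"
  by (simp add: right_kernel_def)

text \<open>An element (1, \<sigma>) of the basilica group is good on all levels, and
  \<open>good_glue_iff\<close> compares \<open>Qsum\<close> of \<sigma> with that of the identity,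
  which is 0. Level 2k gives the modulus 2^k.\<close>

lemma right_kernel_good: "\<sigma> \<in> right_kernel \<Longrightarrow> good n \<sigma>"
  and right_kernel_Qsum: "\<sigma> \<in> right_kernel \<Longrightarrow> Qsum \<sigma> [] = 0"
proof -
  assume "\<sigma> \<in> right_kernel"
  then have *: "good n \<sigma> \<and> 2 ^ (n div 2) dvd Qsum \<sigma> [] - Qsum id []" for n
    using good_glue_iff[OF tree_auts_id, of \<sigma> n] good_B_inf unfolding right_kernel_def by blast
  then show "good n \<sigma>"
    by blast
  have "2 ^ k dvd Qsum \<sigma> [] - 0" for k
    using *[of "2 * k"] by simp
  then show "Qsum \<sigma> [] = 0"
    by (rule two_adic_eq_if_dvd)
qed

lemma right_kernel_id: "id \<in> right_kernel"
  unfolding right_kernel_def using tree_auts_id B_inf_id by (simp only: glue_id mem_Collect_eq)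

lemma right_kernel_alpha: "alpha \<in> right_kernel"
  unfolding right_kernel_def using alpha_tree_auts B_inf_beta by (simp flip: beta_eq_glue)

lemma right_kernel_comp:
  assumes "\<sigma> \<in> right_kernel" "\<tau> \<in> right_kernel"
  shows "\<sigma> \<circ> \<tau> \<in> right_kernel"
proof -
  have "glue id \<sigma> \<circ> glue id \<tau> \<in> B_inf"
    using assms unfolding right_kernel_def by (intro B_inf_comp) blast+
  then show ?thesis
    using assms tree_auts_comp unfolding right_kernel_def glue_comp comp_id by blast
qed

lemma right_kernel_inv:
  assumes "\<sigma> \<in> right_kernel"
  shows "inv_into UNIV \<sigma> \<in> right_kernel"
  using assms B_inf_inv[of "glue id \<sigma>"] tree_auts_inv inv_glue[OF tree_auts_id, of \<sigma>]
  unfolding right_kernel_def by (simp only: inv_id mem_Collect_eq)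

text \<open>Conjugate (1, \<sigma>) by the square of \<open>alpha\<close>, that is by
  (\<open>beta\<close>, \<open>beta\<close>); the first coordinate stays trivial.\<close>

lemma right_kernel_conj_beta:
  assumes "\<sigma> \<in> right_kernel"
  shows "beta \<circ> \<sigma> \<circ> inv_into UNIV beta \<in> right_kernel"
proof -
  note b = beta_tree_auts
  have bb: "glue beta beta \<in> B_inf"
    using B_inf_comp[OF B_inf_alpha B_inf_alpha] by (simp only: alpha_squared)
  have "glue beta beta \<circ> glue id \<sigma> \<circ> inv_into UNIV (glue beta beta) \<in> B_inf"
    using assms bb unfolding right_kernel_def by (blast intro: B_inf_comp B_inf_inv)
  then have "glue id (beta \<circ> \<sigma> \<circ> inv_into UNIV beta) \<in> B_inf"
    by (simp only: inv_glue[OF b b] glue_comp comp_id comp_inv[OF b])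
  then show ?thesis
    using assms unfolding right_kernel_def by (blast intro: tree_auts_comp tree_auts_inv b)
qed

lemma beta_power_right_kernel:
  assumes "\<sigma> \<in> right_kernel"
  shows "\<exists>\<sigma>'\<in>right_kernel. beta ^^ m \<circ> \<sigma> = \<sigma>' \<circ> beta ^^ m"
proof (induction m)
  case 0
  then show ?case
    using assms by (intro bexI[of _ \<sigma>]) (simp_all only: funpow.simps id_comp comp_id)
next
  case (Suc m)
  then obtain \<sigma>' where \<sigma>': "\<sigma>' \<in> right_kernel" "beta ^^ m \<circ> \<sigma> = \<sigma>' \<circ> beta ^^ m"
    by blast
  have "beta ^^ Suc m \<circ> \<sigma> = beta \<circ> \<sigma>' \<circ> beta ^^ m"
    by (simp only: funpow.simps comp_assoc \<sigma>'(2))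
  also have "\<dots> = (beta \<circ> \<sigma>' \<circ> inv_into UNIV beta) \<circ> beta ^^ Suc m"
    by (simp only: funpow.simps comp_assoc inv_comp_cancel[OF beta_tree_auts])
  finally show ?case
    using right_kernel_conj_beta[OF \<sigma>'(1)] by blast
qed

text \<open>Agreement on T_n suffices and allows natural exponents, since \<open>beta\<close> has
  finite order there. Products are sorted by moving powers of \<open>beta\<close> to the right past
  elements of R.\<close>

lemma B_inf_decompose:
  assumes "\<sigma> \<in> B_inf"
  shows "\<exists>\<rho>\<in>right_kernel. \<exists>m. agree n \<sigma> (\<rho> \<circ> beta ^^ m)"
  using assms
proof (induction rule: B_inf_induct)
  case id
  show ?case
    by (intro bexI[OF _ right_kernel_id] exI[of _ 0]) (simp only: funpow.simps comp_id agree_refl)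
next
  case alpha
  show ?case
    by (intro bexI[OF _ right_kernel_alpha] exI[of _ 0]) (simp only: funpow.simps comp_id agree_refl)
next
  case beta
  show ?case
    by (intro bexI[OF _ right_kernel_id] exI[of _ "Suc 0"])
      (simp only: funpow.simps comp_id id_comp agree_refl)
next
  case inv_alpha
  show ?case
    by (intro bexI[OF _ right_kernel_inv[OF right_kernel_alpha]] exI[of _ 0])
      (simp only: funpow.simps comp_id agree_refl)
next
  case inv_beta
  note b = beta_tree_auts
  \<comment> \<open>On T_n the power of \<open>beta\<close> with exponent one less than
    \<open>2 ^ (n div 2)\<close> is its inverse.\<close>
  obtain m where m: "2 ^ (n div 2) = Suc m"
    using not0_implies_Suc[of "2 ^ (n div 2)"] by auto
  have "agree n (inv_into UNIV beta \<circ> beta ^^ Suc m) (inv_into UNIV beta \<circ> id)"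
    using alpha_beta_order[of n] unfolding m[symmetric]
    by (intro agree_comp agree_refl funpow_tree_auts b) blast
  then have "agree n (id \<circ> beta ^^ m) (inv_into UNIV beta)"
    by (simp only: funpow.simps inv_comp_cancel[OF b] comp_id id_comp)
  then show ?case
    using right_kernel_id agree_sym by blast
next
  case (comp \<sigma> \<tau>)
  then obtain \<rho> \<rho>' m m' where \<rho>: "\<rho> \<in> right_kernel" "agree n \<sigma> (\<rho> \<circ> beta ^^ m)"
    and \<rho>': "\<rho>' \<in> right_kernel" "agree n \<tau> (\<rho>' \<circ> beta ^^ m')"
    by blast
  obtain \<rho>'' where \<rho>'': "\<rho>'' \<in> right_kernel" "beta ^^ m \<circ> \<rho>' = \<rho>'' \<circ> beta ^^ m"
    using beta_power_right_kernel[OF \<rho>'(1)] by blast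
  have "agree n (\<sigma> \<circ> \<tau>) ((\<rho> \<circ> beta ^^ m) \<circ> (\<rho>' \<circ> beta ^^ m'))"
    using \<rho>(2) \<rho>'(2) B_inf_tree_auts[OF comp.hyps(2)] by (rule agree_comp)
  also have "(\<rho> \<circ> beta ^^ m) \<circ> (\<rho>' \<circ> beta ^^ m') = \<rho> \<circ> (beta ^^ m \<circ> \<rho>') \<circ> beta ^^ m'"
    by (simp only: comp_assoc)
  also have "\<dots> = (\<rho> \<circ> \<rho>'') \<circ> beta ^^ (m + m')"
    by (simp only: \<rho>''(2) comp_assoc funpow_add)
  finally show ?case
    using right_kernel_comp[OF \<rho>(1) \<rho>''(1)] by blast
qed

text \<open>\<open>Qsum\<close> recovers the exponent m of the decomposition modulo
  \<open>2 ^ (n div 2)\<close>. The same number bounds the order of \<open>beta\<close> on T_n, so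
  divisibility of m makes the power of \<open>beta\<close> invisible there.\<close>

lemma B_inf_agree_right_kernel:
  assumes \<sigma>: "\<sigma> \<in> B_inf" and dvd: "2 ^ (n div 2) dvd Qsum \<sigma> []"
  shows "\<exists>\<rho>\<in>right_kernel. agree n \<rho> \<sigma>"
proof -
  obtain \<rho> m where \<rho>: "\<rho> \<in> right_kernel" "agree n \<sigma> (\<rho> \<circ> beta ^^ m)"
    using B_inf_decompose[OF \<sigma>] by blast
  note \<rho>_aut = right_kernel_tree_auts[OF \<rho>(1)] and beta_aut = funpow_tree_auts[OF beta_tree_auts]
  have "Qsum (\<rho> \<circ> beta ^^ m) [] = of_nat m"
    using Qsum_comp_eq[OF \<rho>_aut beta_aut[of m] right_kernel_good[OF \<rho>(1)]]
    by (simp only: right_kernel_Qsum[OF \<rho>(1)] Qsum_beta_power add_0)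
  then have "2 ^ (n div 2) dvd Qsum \<sigma> [] - of_nat m"
    using agree_Qsum[OF \<rho>(2), of "[]" "n div 2"] by simp
  from dvd_diff[OF dvd this] have "2 ^ (n div 2) dvd (of_nat m :: two_adic)"
    by simp
  then have "int m mod 2 ^ (n div 2) = 0"
    by (simp only: two_power_dvd_iff residue_of_nat)
  then have "2 ^ (n div 2) dvd m"
    by (metis mod_0_imp_dvd of_nat_dvd_iff of_nat_numeral of_nat_power)
  then obtain j where j: "m = 2 ^ (n div 2) * j" ..
  have "agree n (beta ^^ m) id"
    using agree_id_funpow[OF conjunct2[OF alpha_beta_order] beta_aut, of n j]
    by (simp only: j funpow_mult mult.commute)
  from agree_comp[OF agree_refl[of n \<rho>] this beta_aut] have "agree n (\<rho> \<circ> beta ^^ m) \<rho>"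
    by (simp only: comp_id)
  with \<rho> show ?thesis
    by (blast intro: agree_sym agree_trans)
qed

lemma B_inf_glue:
  assumes "\<sigma> \<in> right_kernel" "\<tau> \<in> right_kernel"
  shows "glue \<sigma> \<tau> \<in> B_inf"
proof -
  have "glue \<sigma> id \<in> B_inf"
    using assms(1) unfolding right_kernel_def alpha_conj_glue[symmetric]
    by (blast intro: B_inf_comp B_inf_inv B_inf_alpha)
  then have "glue \<sigma> id \<circ> glue id \<tau> \<in> B_inf"
    using assms(2) unfolding right_kernel_def by (blast intro: B_inf_comp)
  then show ?thesis
    by (simp only: glue_comp comp_id id_comp)
qed

section \<open>Density of the basilica group in the good automorphisms\<close>

lemma B_inf_funpow: "\<sigma> \<in> B_inf \<Longrightarrow> \<sigma> ^^ m \<in> B_inf"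
  by (induction m) (simp_all only: funpow.simps B_inf_id B_inf_comp)

lemma B_inf_agree_cancel:
  assumes \<gamma>: "\<gamma> \<in> B_inf" and \<tau>: "\<tau> \<in> B_inf" and agree: "agree n \<tau> (\<gamma> \<circ> \<sigma>)"
  shows "\<exists>\<tau>\<in>B_inf. agree n \<tau> \<sigma>"
proof -
  have "agree n (inv_into UNIV \<gamma> \<circ> \<tau>) (inv_into UNIV \<gamma> \<circ> (\<gamma> \<circ> \<sigma>))"
    using agree B_inf_tree_auts[OF \<tau>] by (intro agree_comp agree_refl)
  then show ?thesis
    using B_inf_comp[OF B_inf_inv[OF \<gamma>] \<tau>] inv_comp_cancel[OF B_inf_tree_auts[OF \<gamma>]] by metis
qed

lemma good_imp_agree_B_inf:
  "\<sigma> \<in> tree_auts UNIV \<Longrightarrow> good n \<sigma> \<Longrightarrow> \<exists>\<tau>\<in>B_inf. agree n \<tau> \<sigma>"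
proof (induction n arbitrary: \<sigma>)
  case 0
  then show ?case
    using B_inf_id tree_auts_root[of \<sigma> UNIV] by (intro bexI[of _ id]) (auto simp: agree_def)
next
  case (Suc n)
  have even: "\<exists>\<tau>\<in>B_inf. agree (Suc n) \<tau> \<sigma>"
    if \<sigma>: "\<sigma> \<in> tree_auts UNIV" and good: "good (Suc n) \<sigma>" and Par: "Par \<sigma> [] = 0" for \<sigma>
  proof -
    let ?k = "n div 2"
    have good_sec: "good n (sec s \<sigma>)" for s
      using good good_Suc_iff[OF \<sigma>] by (cases s) auto
    have diff: "2 ^ ?k dvd Qsum (sec Lb \<sigma>) [] - Qsum (sec La \<sigma>) []"
      using good good_Suc_iff[OF \<sigma>, of n] Par by simp
    \<comment> \<open>As \<open>Qsum\<close> of the m-th power of \<open>beta\<close> is m, this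
      power cancels \<open>Qsum\<close> of the section at a; the same m serves at b because the two
      values are congruent.\<close>
    define m where "m = nat (residue (- Qsum (sec La \<sigma>) []) ?k)"
    have "2 ^ ?k dvd of_nat m - (- Qsum (sec La \<sigma>) [])"
      unfolding two_power_dvd_diff_iff m_def residue_of_nat
      using residue_range(1) residue_mod_self by simp
    then have La: "2 ^ ?k dvd of_nat m + Qsum (sec La \<sigma>) []"
      by simp
    then have Lb: "2 ^ ?k dvd of_nat m + Qsum (sec Lb \<sigma>) []"
      using dvd_add[OF La diff] by simp
    have "\<exists>\<rho>\<in>right_kernel. agree n \<rho> (beta ^^ m \<circ> sec s \<sigma>)" for s
    proof -
      note s = sec_tree_auts[OF \<sigma>, of s] and b = funpow_tree_auts[OF beta_tree_auts, of m]
      have "good n (beta ^^ m \<circ> sec s \<sigma>)"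
        using good_comp_iff[OF b s] good_sec[of s] good_funpow[OF beta_tree_auts good_beta] by blast
      then obtain \<tau> where \<tau>: "\<tau> \<in> B_inf" "agree n \<tau> (beta ^^ m \<circ> sec s \<sigma>)"
        using Suc.IH tree_auts_comp[OF b s] by blast
      have "2 ^ ?k dvd Qsum (beta ^^ m \<circ> sec s \<sigma>) []"
        unfolding Qsum_beta_power_comp[OF s] using La Lb by (cases s) simp_all
      \<comment> \<open>\<open>Qsum\<close> modulo 2^k, with k = \<open>n div 2\<close>, is
        determined on T_n, so the approximation \<tau> inherits the divisibility.\<close>
      with agree_Qsum[OF \<tau>(2), of "[]" ?k] have "2 ^ ?k dvd Qsum \<tau> []"
        by (simp add: dvd_diff_left_iff)
      then show ?thesis
        using B_inf_agree_right_kernel[OF \<tau>(1)] \<tau>(2) agree_trans by blast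
    qed
    then obtain \<rho> where \<rho>: "\<And>s. \<rho> s \<in> right_kernel"
      "\<And>s. agree n (\<rho> s) (beta ^^ m \<circ> sec s \<sigma>)"
      by metis
    have "agree (Suc n) (glue (\<rho> La) (\<rho> Lb))
        (glue (beta ^^ m \<circ> sec La \<sigma>) (beta ^^ m \<circ> sec Lb \<sigma>))"
      by (intro agree_glue \<rho>)
    \<comment> \<open>Correcting both sections by the same power of \<open>beta\<close> is left
      multiplication by an element of the basilica group, which can be cancelled.\<close>
    also have "glue (beta ^^ m \<circ> sec La \<sigma>) (beta ^^ m \<circ> sec Lb \<sigma>) = alpha ^^ (2 * m) \<circ> \<sigma>"
      unfolding glue_comp[symmetric] alpha_power glue_sec[OF \<sigma> Par] ..
    finally show ?thesis
      using B_inf_agree_cancel[OF B_inf_funpow[OF B_inf_alpha] B_inf_glue[OF \<rho>(1) \<rho>(1)]] by blast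
  qed
  show ?case
  proof (cases "Par \<sigma> [] = 0")
    case True
    then show ?thesis
      using even Suc.prems by blast
  next
    case False
    then have "Par (alpha \<circ> \<sigma>) [] = 0"
      using Suc.prems by (simp add: Par_comp[OF alpha_tree_auts] tree_auts_root[of \<sigma> UNIV] Par_alpha_root)
    moreover have "good (Suc n) (alpha \<circ> \<sigma>)"
      using Suc.prems good_comp_iff[OF alpha_tree_auts Suc.prems(1) good_alpha] by blast
    ultimately obtain \<tau> where "\<tau> \<in> B_inf" "agree (Suc n) \<tau> (alpha \<circ> \<sigma>)"
      using even tree_auts_comp[OF alpha_tree_auts Suc.prems(1)] by blast
    then show ?thesis
      using B_inf_agree_cancel[OF B_inf_alpha] by blast
  qed
qed

section \<open>Counting\<close>

text \<open>These act on the infinite tree; only their restrictions are counted. Composition,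
  sections and \<open>Qsum\<close> thus need no counterpart on T_n.\<close>

definition good_auts :: "nat \<Rightarrow> (node \<Rightarrow> node) set" where
  "good_auts n = {\<sigma> \<in> tree_auts UNIV. good n \<sigma>}"

abbreviation res :: "nat \<Rightarrow> (node \<Rightarrow> node) \<Rightarrow> node \<Rightarrow> node" where
  "res n \<sigma> \<equiv> restrict \<sigma> (nodes n)"

lemma res_eq_iff: "res n \<sigma> = res n \<tau> \<longleftrightarrow> agree n \<sigma> \<tau>"
  by (auto simp: fun_eq_iff agree_def nodes_def restrict_def)

text \<open>Independence of the extension chosen by \<open>SOME\<close>: two extensions agree on
  T_n, which determines P to exactly this precision. For exponent 0 both residues are 0.\<close>

lemma P_fin_res:
  assumes \<sigma>: "\<sigma> \<in> tree_auts UNIV" and x: "x \<in> nodes n"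
  shows "P_fin n (res n \<sigma>) x = residue (P_inv \<sigma> x) ((n - length x + 1) div 2)"
proof -
  define \<sigma>' where "\<sigma>' = (SOME \<sigma>'. extends n (res n \<sigma>) \<sigma>')"
  have "extends n (res n \<sigma>) \<sigma>'"
    unfolding \<sigma>'_def by (rule someI[of _ \<sigma>]) (use \<sigma> in \<open>unfold extends_def, blast\<close>)
  then have agree: "agree n \<sigma>' \<sigma>"
    unfolding extends_def res_eq_iff by blast
  have "residue (P_inv \<sigma>' x) ((n - length x + 1) div 2) = residue (P_inv \<sigma> x) ((n - length x + 1) div 2)"
  proof (cases "(n - length x + 1) div 2")
    case (Suc k)
    then have "length x + 2 * k < n"
      by presburger
    from agree_P_inv[OF agree this] show ?thesis
      unfolding Suc two_power_dvd_diff_iff .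
  qed simp
  then show ?thesis
    by (simp add: P_fin_def \<sigma>'_def)
qed

lemma good_iff_nodes:
  "good n \<sigma> \<longleftrightarrow> (\<forall>x\<in>nodes n. 2 ^ ((n - length x + 1) div 2) dvd P_inv \<sigma> x - 1)"
proof (intro iffI ballI)
  fix x
  assume "good n \<sigma>" "x \<in> nodes n"
  show "2 ^ ((n - length x + 1) div 2) dvd P_inv \<sigma> x - 1"
  proof (cases "(n - length x + 1) div 2")
    case (Suc k)
    then have "length x + 2 * k < n"
      by presburger
    with \<open>good n \<sigma>\<close> show ?thesis
      unfolding Suc good_def by blast
  qed simp
next
  assume *: "\<forall>x\<in>nodes n. 2 ^ ((n - length x + 1) div 2) dvd P_inv \<sigma> x - 1"
  show "good n \<sigma>"
    unfolding good_def
  proof (intro allI impI)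
    fix x :: node and k
    assume len: "length x + 2 * k < n"
    then have "Suc k \<le> (n - length x + 1) div 2"
      by presburger
    moreover have "x \<in> nodes n"
      using len by (simp add: nodes_def)
    ultimately show "2 ^ Suc k dvd P_inv \<sigma> x - 1"
      using * by (blast intro: dvd_trans le_imp_power_dvd)
  qed
qed

lemma cong_residue_one_iff: "[residue a k = 1] (mod 2 ^ k) \<longleftrightarrow> 2 ^ k dvd a - 1"
  by (simp add: cong_def residue_mod_self two_power_dvd_diff_iff one_two_adic.rep_eq)

lemma res_in_B'_fin_iff:
  assumes \<sigma>: "\<sigma> \<in> tree_auts UNIV"
  shows "res n \<sigma> \<in> B'_fin n \<longleftrightarrow> good n \<sigma>"
proof -
  let ?k = "\<lambda>x. (n - length x + 1) div 2"
  let ?P = "P_fin n (res n \<sigma>)"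
  have one: "[?P x = 1] (mod 2 ^ ?k x) \<longleftrightarrow> 2 ^ ?k x dvd P_inv \<sigma> x - 1" if "x \<in> nodes n" for x
    unfolding P_fin_res[OF \<sigma> that] by (rule cong_residue_one_iff)
  \<comment> \<open>The exponent at x is at most the one at the root, so the congruence at the root
    may be weakened to the precision available at x.\<close>
  have root: "[?P [] = 1] (mod 2 ^ ?k x)" if "[?P [] = 1] (mod 2 ^ ((n + 1) div 2))" for x :: node
    using that by (rule cong_dvd_modulus) (intro le_imp_power_dvd div_le_mono, simp)
  have "res n \<sigma> \<in> B'_fin n \<longleftrightarrow>
      (\<forall>x\<in>nodes n. [?P x = ?P []] (mod 2 ^ ?k x)) \<and> [?P [] = 1] (mod 2 ^ ((n + 1) div 2))"
    by (simp add: B'_fin_def M_fin_def tree_auts_restrict[OF \<sigma>])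
  also have "\<dots> \<longleftrightarrow> (\<forall>x\<in>nodes n. [?P x = 1] (mod 2 ^ ?k x))"
  proof (intro iffI conjI ballI)
    assume *: "\<forall>x\<in>nodes n. [?P x = 1] (mod 2 ^ ?k x)"
    then have **: "[?P [] = 1] (mod 2 ^ ((n + 1) div 2))"
      using Nil_in_nodes[of n] by fastforce
    then show "[?P [] = 1] (mod 2 ^ ((n + 1) div 2))" .
    show "[?P x = ?P []] (mod 2 ^ ?k x)" if "x \<in> nodes n" for x
      using * that root[OF **, of x] cong_sym cong_trans by blast
  next
    fix x
    assume *: "(\<forall>x\<in>nodes n. [?P x = ?P []] (mod 2 ^ ?k x)) \<and> [?P [] = 1] (mod 2 ^ ((n + 1) div 2))"
      and "x \<in> nodes n"
    then show "[?P x = 1] (mod 2 ^ ?k x)"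
      using root[of x] cong_trans by blast
  qed
  finally show ?thesis
    using one by (simp add: good_iff_nodes)
qed

lemma B'_fin_eq: "B'_fin n = res n ` good_auts n"
proof (intro equalityI subsetI)
  fix \<tau>
  assume \<tau>: "\<tau> \<in> B'_fin n"
  then have "\<tau> \<in> tree_auts (nodes n)"
    by (simp add: B'_fin_def M_fin_def)
  then obtain \<sigma> where "\<sigma> \<in> tree_auts UNIV" "res n \<sigma> = \<tau>"
    using extends_exists unfolding extends_def by blast
  with \<tau> show "\<tau> \<in> res n ` good_auts n"
    using res_in_B'_fin_iff[of \<sigma> n] by (auto simp: good_auts_def)
qed (auto simp: good_auts_def res_in_B'_fin_iff)

lemma B_fin_eq: "B_fin n = res n ` good_auts n"
proof (intro equalityI subsetI)
  fix \<tau>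
  assume "\<tau> \<in> res n ` good_auts n"
  then obtain \<sigma> where \<sigma>: "\<sigma> \<in> tree_auts UNIV" "good n \<sigma>" "\<tau> = res n \<sigma>"
    by (auto simp: good_auts_def)
  then obtain \<rho> where "\<rho> \<in> B_inf" "agree n \<rho> \<sigma>"
    using good_imp_agree_B_inf by blast
  then show "\<tau> \<in> B_fin n"
    unfolding B_fin_def \<sigma>(3) res_eq_iff[symmetric] by (metis imageI)
qed (auto simp: B_fin_def good_auts_def B_inf_tree_auts good_B_inf)

text \<open>Maps with the same fibres on X have images in bijection, whether or not X is finite;
  here X is a set of automorphisms of the infinite tree.\<close>

lemma card_image_eq:
  assumes "\<And>x y. x \<in> X \<Longrightarrow> y \<in> X \<Longrightarrow> f x = f y \<longleftrightarrow> g x = g y"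
  shows "card (f ` X) = card (g ` X)"
proof -
  define h where "h z = g (inv_into X f z)" for z
  have h: "h (f x) = g x" if "x \<in> X" for x
    unfolding h_def using assms[of "inv_into X f (f x)" x] that
    by (simp add: inv_into_into f_inv_into_f)
  then have "g ` X = h ` f ` X"
    by (force simp: image_image)
  moreover have "inj_on h (f ` X)"
    using assms h by (auto simp: inj_on_def)
  ultimately show ?thesis
    by (simp add: card_image)
qed

text \<open>Counting principle for the decompositions below, in which f parametrises restrictions by
  pairs and g, h tell when the two components are to be identified.\<close>

lemma card_image_Times:
  assumes "\<And>x x' y y'. x \<in> X \<Longrightarrow> x' \<in> X \<Longrightarrow> y \<in> Y \<Longrightarrow> y' \<in> Y \<Longrightarrow>
    f (x, y) = f (x', y') \<longleftrightarrow> g x = g x' \<and> h y = h y'"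
  shows "card (f ` (X \<times> Y)) = card (g ` X) * card (h ` Y)"
proof -
  have "card (f ` (X \<times> Y)) = card (map_prod g h ` (X \<times> Y))"
    using assms by (intro card_image_eq) auto
  also have "map_prod g h ` (X \<times> Y) = g ` X \<times> h ` Y"
    by force
  finally show ?thesis
    by (simp add: card_cartesian_product)
qed

lemma agree_mono: "agree n \<sigma> \<tau> \<Longrightarrow> m \<le> n \<Longrightarrow> agree m \<sigma> \<tau>"
  by (simp add: agree_def)

lemma agree_comp_left_iff:
  assumes "\<gamma> \<in> tree_auts UNIV"
  shows "agree n (\<gamma> \<circ> \<sigma>) (\<gamma> \<circ> \<tau>) \<longleftrightarrow> agree n \<sigma> \<tau>"
  using tree_auts_bij[OF assms] by (simp add: agree_def bij_def inj_eq)

lemma agree_glue_iff: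
  "agree (Suc n) (glue \<sigma> \<tau>) (glue \<sigma>' \<tau>') \<longleftrightarrow> agree n \<sigma> \<sigma>' \<and> agree n \<tau> \<tau>'"
proof
  assume *: "agree (Suc n) (glue \<sigma> \<tau>) (glue \<sigma>' \<tau>')"
  have "glue \<sigma> \<tau> (s # w) = glue \<sigma>' \<tau>' (s # w)" if "length w \<le> n" for s w
    using * that by (simp add: agree_def)
  from this[of _ La] this[of _ Lb] show "agree n \<sigma> \<sigma>' \<and> agree n \<tau> \<tau>'"
    by (simp add: agree_def)
qed (blast intro: agree_glue)

text \<open>The kernel of \<open>Qsum\<close> at the root modulo \<open>2 ^ (n div 2)\<close>, on
  which it is a homomorphism by \<open>Qsum_comp\<close>.\<close>

definition kernel_auts :: "nat \<Rightarrow> (node \<Rightarrow> node) set" where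
  "kernel_auts n = {\<sigma> \<in> good_auts n. 2 ^ (n div 2) dvd Qsum \<sigma> []}"

text \<open>The powers of \<open>beta\<close> with exponent below \<open>2 ^ (n div 2)\<close>
  represent the cosets of the kernel, as \<open>Qsum\<close> takes each residue on exactly one of
  them.\<close>

lemma card_good_auts: "card (res n ` good_auts n) = 2 ^ (n div 2) * card (res n ` kernel_auts n)"
proof -
  note b = funpow_tree_auts[OF beta_tree_auts]
  note gb = good_funpow[OF beta_tree_auts good_beta]
  let ?k = "n div 2"
  let ?f = "\<lambda>(m, \<sigma>). res n (beta ^^ m \<circ> \<sigma>)"
  have "res n ` good_auts n = ?f ` ({..<2 ^ ?k} \<times> kernel_auts n)"
  proof (intro equalityI subsetI)
    fix \<tau>
    assume "\<tau> \<in> res n ` good_auts n"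
    then obtain \<sigma> where \<sigma>: "\<sigma> \<in> tree_auts UNIV" "good n \<sigma>" "\<tau> = res n \<sigma>"
      by (auto simp: good_auts_def)
    define m where "m = nat (residue (Qsum \<sigma> []) ?k)"
    define \<rho> where "\<rho> = inv_into UNIV (beta ^^ m) \<circ> \<sigma>"
    have \<rho>: "\<rho> \<in> tree_auts UNIV" "beta ^^ m \<circ> \<rho> = \<sigma>"
      unfolding \<rho>_def using \<sigma> b by (simp_all only: tree_auts_comp tree_auts_inv comp_inv_cancel)
    have "m < 2 ^ ?k"
      using residue_range[of "Qsum \<sigma> []" ?k] by (simp add: m_def nat_less_iff)
    moreover have "good n \<rho>"
      using good_comp_iff[OF b[of m] \<rho>(1) gb, of n] \<sigma>(2) unfolding \<rho>(2) by blast
    moreover have "2 ^ ?k dvd Qsum \<rho> []"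
    proof -
      have "2 ^ ?k dvd Qsum \<sigma> [] - of_nat m"
        unfolding two_power_dvd_diff_iff m_def residue_of_nat
        using residue_range(1) residue_mod_self by simp
      then show ?thesis
        using Qsum_beta_power_comp[OF \<rho>(1), of m] by (simp only: \<rho>(2)) simp
    qed
    ultimately have "(m, \<rho>) \<in> {..<2 ^ ?k} \<times> kernel_auts n"
      using \<rho>(1) by (simp add: kernel_auts_def good_auts_def)
    moreover have "\<tau> = ?f (m, \<rho>)"
      by (simp only: \<sigma>(3) \<rho>(2) prod.case)
    ultimately show "\<tau> \<in> ?f ` ({..<2 ^ ?k} \<times> kernel_auts n)"
      by blast
  next
    fix \<tau>
    assume "\<tau> \<in> ?f ` ({..<2 ^ ?k} \<times> kernel_auts n)"
    then obtain m \<sigma> where "\<sigma> \<in> tree_auts UNIV" "good n \<sigma>" "\<tau> = res n (beta ^^ m \<circ> \<sigma>)"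
      by (auto simp: kernel_auts_def good_auts_def)
    then show "\<tau> \<in> res n ` good_auts n"
      using tree_auts_comp[OF b[of m], of \<sigma>] good_comp_iff[OF b[of m] _ gb, of \<sigma>]
      unfolding good_auts_def by blast
  qed
  moreover have "card (?f ` ({..<2 ^ ?k} \<times> kernel_auts n))
      = card (id ` {..<2 ^ ?k :: nat}) * card (res n ` kernel_auts n)"
  proof (rule card_image_Times)
    fix m m' :: nat and \<sigma> \<sigma>'
    assume m: "m \<in> {..<2 ^ ?k}" "m' \<in> {..<2 ^ ?k}" and \<sigma>: "\<sigma> \<in> kernel_auts n" "\<sigma>' \<in> kernel_auts n"
    have aut: "\<sigma> \<in> tree_auts UNIV" "\<sigma>' \<in> tree_auts UNIV"
      and dvd: "2 ^ ?k dvd Qsum \<sigma>' [] - Qsum \<sigma> []"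
      using \<sigma> by (auto simp: kernel_auts_def good_auts_def intro: dvd_diff)
    \<comment> \<open>Both exponents lie below 2^k, with k = \<open>n div 2\<close>, and are
      recovered modulo 2^k from \<open>Qsum\<close>, to which kernel elements contribute
      nothing.\<close>
    have "m = m'" if "agree n (beta ^^ m \<circ> \<sigma>) (beta ^^ m' \<circ> \<sigma>')"
    proof -
      have "2 ^ ?k dvd (of_nat m + Qsum \<sigma> []) - (of_nat m' + Qsum \<sigma>' [])"
        using agree_Qsum[OF that, of "[]" ?k] by (simp only: Qsum_beta_power_comp aut) simp
      from dvd_add[OF this dvd] have "2 ^ ?k dvd (of_nat m - of_nat m' :: two_adic)"
        by (simp add: algebra_simps)
      then have "int m mod 2 ^ ?k = int m' mod 2 ^ ?k"
        by (simp only: two_power_dvd_diff_iff residue_of_nat)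
      then have "int (m mod 2 ^ ?k) = int (m' mod 2 ^ ?k)"
        by (simp only: zmod_int of_nat_power of_nat_numeral)
      then show ?thesis
        using m by simp
    qed
    then show "?f (m, \<sigma>) = ?f (m', \<sigma>') \<longleftrightarrow> id m = id m' \<and> res n \<sigma> = res n \<sigma>'"
      unfolding prod.case res_eq_iff id_apply using agree_comp_left_iff[OF b] by blast
  qed
  ultimately show ?thesis
    by simp
qed

lemma card_good_auts_Suc:
  "card (res (Suc n) ` good_auts (Suc n)) = 2 * (card (res n ` good_auts n) * card (res n ` kernel_auts n))"
proof -
  note a = funpow_tree_auts[OF alpha_tree_auts]
  note ga = good_funpow[OF alpha_tree_auts good_alpha]
  let ?k = "n div 2"
  \<comment> \<open>Writing the second section as \<sigma> followed on the right by \<tau> turns the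
    congruence between the two sections into membership of \<tau> in the kernel, so the parameters
    range over a full product. The factor 2 comes from the root swap.\<close>
  let ?g = "\<lambda>(\<sigma>, \<tau>). glue \<sigma> (\<sigma> \<circ> \<tau>)"
  let ?f = "\<lambda>(i, p). res (Suc n) (alpha ^^ i \<circ> ?g p)"
  let ?Y = "good_auts n \<times> kernel_auts n"
  have glue_aut: "?g p \<in> tree_auts UNIV" if "p \<in> ?Y" for p
    using that by (auto simp: good_auts_def kernel_auts_def intro!: glue_tree_auts tree_auts_comp
        simp del: comp_apply)
  have Par_glue: "Par (?g p) [] = 0" if "p \<in> ?Y" for p
    using that by (auto simp: good_auts_def kernel_auts_def tree_auts_root intro!: Par_glue(1))
  have Par: "Par (alpha ^^ i \<circ> \<sigma>) [] = i" if "\<sigma> \<in> tree_auts UNIV" "Par \<sigma> [] = 0" "i < 2" for i \<sigma>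
  proof -
    have "i = 0 \<or> i = 1"
      using that(3) by auto
    then show ?thesis
      using that Par_comp[OF a[of i] that(1)] by (auto simp: tree_auts_root[OF that(1)] Par_alpha_root)
  qed
  have "res (Suc n) ` good_auts (Suc n) = ?f ` ({..<2} \<times> ?Y)"
  proof (intro equalityI subsetI)
    fix \<tau>
    assume "\<tau> \<in> res (Suc n) ` good_auts (Suc n)"
    then obtain \<sigma> where \<sigma>: "\<sigma> \<in> tree_auts UNIV" "good (Suc n) \<sigma>" "\<tau> = res (Suc n) \<sigma>"
      by (auto simp: good_auts_def)
    obtain i \<rho> where i: "i < 2" and \<rho>: "\<rho> \<in> tree_auts UNIV" "alpha ^^ i \<circ> \<rho> = \<sigma>" "Par \<rho> [] = 0"
    proof (cases "Par \<sigma> [] = 0")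
      case True
      with \<sigma> show ?thesis
        by (intro that[of 0 \<sigma>]) simp_all
    next
      case False
      define \<rho> where "\<rho> = inv_into UNIV alpha \<circ> \<sigma>"
      have \<rho>: "\<rho> \<in> tree_auts UNIV" "alpha \<circ> \<rho> = \<sigma>"
        unfolding \<rho>_def using \<sigma> alpha_tree_auts
        by (simp_all only: tree_auts_comp tree_auts_inv comp_inv_cancel)
      moreover have "Par \<rho> [] = 0"
        using False Par_comp[OF alpha_tree_auts \<rho>(1), of "[]"] unfolding \<rho>(2)
        by (auto simp: tree_auts_root[OF \<rho>(1)] Par_alpha_root split: if_splits)
      moreover have "alpha ^^ 1 \<circ> \<rho> = \<sigma>"
        using \<rho>(2) by (simp only: One_nat_def funpow.simps comp_id)
      ultimately show ?thesis
        by (intro that[of 1 \<rho>]) (simp, assumption+)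
    qed
    note aut = sec_tree_auts[OF \<rho>(1)]
    define \<mu> where "\<mu> = inv_into UNIV (sec La \<rho>) \<circ> sec Lb \<rho>"
    have \<mu>: "\<mu> \<in> tree_auts UNIV" "sec La \<rho> \<circ> \<mu> = sec Lb \<rho>"
      unfolding \<mu>_def using aut by (simp_all only: tree_auts_comp tree_auts_inv comp_inv_cancel)
    have "good (Suc n) \<rho>"
      using good_comp_iff[OF a[of i] \<rho>(1) ga, of "Suc n"] \<sigma>(2) unfolding \<rho>(2) by blast
    then have good: "good n (sec La \<rho>)" "good n (sec Lb \<rho>)"
      and dvd: "2 ^ ?k dvd Qsum (sec Lb \<rho>) [] - Qsum (sec La \<rho>) []"
      using good_Suc_iff[OF \<rho>(1), of n] \<rho>(3) by simp_all
    have "good n \<mu>"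
      using good_comp_iff[OF aut \<mu>(1) good(1)] good(2) unfolding \<mu>(2) by blast
    moreover have "2 ^ ?k dvd Qsum \<mu> []"
    proof -
      have "2 ^ ?k dvd Qsum (sec Lb \<rho>) [] - Qsum (sec La \<rho>) [] - Qsum \<mu> []"
        using Qsum_comp[OF aut \<mu>(1) good(1), of "[]" ?k]
        by (simp only: \<mu>(2)) (simp add: tree_auts_root[OF \<mu>(1)])
      from dvd_diff[OF dvd this] show ?thesis
        by simp
    qed
    ultimately have "(i, sec La \<rho>, \<mu>) \<in> {..<2} \<times> ?Y"
      using i good(1) \<mu>(1) aut by (simp add: kernel_auts_def good_auts_def)
    moreover have "\<tau> = ?f (i, sec La \<rho>, \<mu>)"
      unfolding prod.case \<mu>(2) glue_sec[OF \<rho>(1,3)] \<rho>(2) \<sigma>(3) ..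
    ultimately show "\<tau> \<in> ?f ` ({..<2} \<times> ?Y)"
      by blast
  next
    fix \<tau>
    assume "\<tau> \<in> ?f ` ({..<2} \<times> ?Y)"
    then obtain i \<sigma> \<mu> where \<sigma>: "\<sigma> \<in> tree_auts UNIV" "good n \<sigma>"
      and \<mu>: "\<mu> \<in> tree_auts UNIV" "good n \<mu>" "2 ^ ?k dvd Qsum \<mu> []"
      and \<tau>: "\<tau> = res (Suc n) (alpha ^^ i \<circ> glue \<sigma> (\<sigma> \<circ> \<mu>))"
      by (auto simp: kernel_auts_def good_auts_def)
    have "2 ^ ?k dvd Qsum (\<sigma> \<circ> \<mu>) [] - Qsum \<sigma> [] - Qsum \<mu> []"
      using Qsum_comp[OF \<sigma>(1) \<mu>(1) \<sigma>(2), of "[]" ?k] by (simp add: tree_auts_root[OF \<mu>(1)])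
    from dvd_add[OF this \<mu>(3)] have "2 ^ ?k dvd Qsum (\<sigma> \<circ> \<mu>) [] - Qsum \<sigma> []"
      by simp
    moreover have "good n (\<sigma> \<circ> \<mu>)" "\<sigma> \<circ> \<mu> \<in> tree_auts UNIV"
      using good_comp_iff[OF \<sigma>(1) \<mu>(1) \<sigma>(2)] \<mu>(2) tree_auts_comp[OF \<sigma>(1) \<mu>(1)] by blast+
    ultimately have "good (Suc n) (glue \<sigma> (\<sigma> \<circ> \<mu>))" "glue \<sigma> (\<sigma> \<circ> \<mu>) \<in> tree_auts UNIV"
      using \<sigma> good_glue_iff glue_tree_auts by blast+
    then show "\<tau> \<in> res (Suc n) ` good_auts (Suc n)"
      unfolding \<tau> good_auts_def using good_comp_iff[OF a _ ga] tree_auts_comp[OF a] by blast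
  qed
  moreover have "card (?f ` ({..<2} \<times> ?Y)) = card (id ` {..<2 :: nat}) * card ((res (Suc n) \<circ> ?g) ` ?Y)"
  proof (rule card_image_Times)
    fix i i' :: nat and p p'
    assume i: "i \<in> {..<2}" "i' \<in> {..<2}" and p: "p \<in> ?Y" "p' \<in> ?Y"
    have "i = i'" if "agree (Suc n) (alpha ^^ i \<circ> ?g p) (alpha ^^ i' \<circ> ?g p')"
      using agree_Par[OF that, of "[]"] Par[OF glue_aut[OF p(1)] Par_glue[OF p(1)], of i]
        Par[OF glue_aut[OF p(2)] Par_glue[OF p(2)], of i'] i by simp
    then show "?f (i, p) = ?f (i', p') \<longleftrightarrow> id i = id i' \<and> (res (Suc n) \<circ> ?g) p = (res (Suc n) \<circ> ?g) p'"
      unfolding prod.case[of _ i] prod.case[of _ i'] comp_apply[of "res (Suc n)" ?g] res_eq_iff id_apply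
      using agree_comp_left_iff[OF a] by blast
  qed
  moreover have "card ((res (Suc n) \<circ> ?g) ` ?Y) = card (res n ` good_auts n) * card (res n ` kernel_auts n)"
  proof (rule card_image_Times)
    fix \<sigma> \<sigma>' \<mu> \<mu>'
    assume "\<sigma> \<in> good_auts n" "\<sigma>' \<in> good_auts n" "\<mu> \<in> kernel_auts n" "\<mu>' \<in> kernel_auts n"
    then have aut: "\<sigma> \<in> tree_auts UNIV" "\<sigma>' \<in> tree_auts UNIV" "\<mu> \<in> tree_auts UNIV" "\<mu>' \<in> tree_auts UNIV"
      by (simp_all add: good_auts_def kernel_auts_def)
    have "agree n (\<sigma> \<circ> \<mu>) (\<sigma>' \<circ> \<mu>') \<longleftrightarrow> agree n \<mu> \<mu>'" if "agree n \<sigma> \<sigma>'"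
      using agree_comp[OF that agree_refl aut(4)] agree_comp_left_iff[OF aut(1), of n \<mu> \<mu>']
        agree_trans agree_sym by blast
    then show "(res (Suc n) \<circ> ?g) (\<sigma>, \<mu>) = (res (Suc n) \<circ> ?g) (\<sigma>', \<mu>') \<longleftrightarrow>
        res n \<sigma> = res n \<sigma>' \<and> res n \<mu> = res n \<mu>'"
      unfolding comp_apply[of "res (Suc n)" ?g] prod.case res_eq_iff agree_glue_iff by blast
  qed
  ultimately show ?thesis
    by simp
qed

lemma E_fin_Suc_eq: "E_fin (Suc n) = res (Suc n) ` {\<sigma> \<in> good_auts (Suc n). agree n \<sigma> id}"
  unfolding E_fin_def B'_fin_eq by (auto simp: agree_def nodes_def)

text \<open>Lagrange for restriction from level n + 1 to level n: its kernel is
  \<open>E_fin (Suc n)\<close>, and chosen lifts represent the cosets.\<close>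

lemma card_E_fin_Suc: "card (res (Suc n) ` good_auts (Suc n)) = card (res n ` good_auts n) * card (E_fin (Suc n))"
proof -
  let ?X = "res n ` good_auts n" and ?Y = "{\<sigma> \<in> good_auts (Suc n). agree n \<sigma> id}"
  \<comment> \<open>Surjectivity of restriction rests on density: an approximating element of the
    basilica group is good on every level, hence also on the next one.\<close>
  have "\<exists>\<rho>. \<rho> \<in> good_auts (Suc n) \<and> res n \<rho> = f" if f: "f \<in> ?X" for f
  proof -
    obtain \<sigma> where \<sigma>: "\<sigma> \<in> tree_auts UNIV" "good n \<sigma>" "f = res n \<sigma>"
      using f unfolding good_auts_def by blast
    then obtain \<rho> where "\<rho> \<in> B_inf" "agree n \<rho> \<sigma>"
      using good_imp_agree_B_inf by blast
    then show ?thesis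
      unfolding \<sigma>(3) res_eq_iff good_auts_def using B_inf_tree_auts good_B_inf by blast
  qed
  then obtain lift where lift: "\<And>f. f \<in> ?X \<Longrightarrow> lift f \<in> good_auts (Suc n)" "\<And>f. f \<in> ?X \<Longrightarrow> res n (lift f) = f"
    by metis
  let ?f = "\<lambda>(f, \<sigma>). res (Suc n) (lift f \<circ> \<sigma>)"
  have "res (Suc n) ` good_auts (Suc n) = ?f ` (?X \<times> ?Y)"
  proof (intro equalityI subsetI)
    fix \<tau>
    assume "\<tau> \<in> res (Suc n) ` good_auts (Suc n)"
    then obtain \<sigma> where \<sigma>: "\<sigma> \<in> tree_auts UNIV" "good (Suc n) \<sigma>" "\<tau> = res (Suc n) \<sigma>"
      by (auto simp: good_auts_def)
    have f: "res n \<sigma> \<in> ?X"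
      using \<sigma> good_mono[of "Suc n" \<sigma> n] by (auto simp: good_auts_def)
    define \<rho> where "\<rho> = lift (res n \<sigma>)"
    have \<rho>: "\<rho> \<in> tree_auts UNIV" "good (Suc n) \<rho>" "agree n \<rho> \<sigma>"
      using lift[OF f] by (simp_all add: \<rho>_def good_auts_def res_eq_iff)
    define \<mu> where "\<mu> = inv_into UNIV \<rho> \<circ> \<sigma>"
    have \<mu>: "\<mu> \<in> tree_auts UNIV" "\<rho> \<circ> \<mu> = \<sigma>"
      unfolding \<mu>_def using \<sigma> \<rho> by (simp_all only: tree_auts_comp tree_auts_inv comp_inv_cancel)
    have "good (Suc n) \<mu>"
      using good_comp_iff[OF \<rho>(1) \<mu>(1) \<rho>(2)] \<sigma>(2) unfolding \<mu>(2) by blast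
    moreover have "agree n \<mu> id"
      using agree_comp_left_iff[OF \<rho>(1), of n \<mu> id] \<rho>(3)[THEN agree_sym] by (simp only: \<mu>(2) comp_id)
    ultimately have "(res n \<sigma>, \<mu>) \<in> ?X \<times> ?Y"
      using f \<mu>(1) by (simp add: good_auts_def)
    moreover have "\<tau> = ?f (res n \<sigma>, \<mu>)"
      unfolding prod.case \<rho>_def[symmetric] \<mu>(2) \<sigma>(3) ..
    ultimately show "\<tau> \<in> ?f ` (?X \<times> ?Y)"
      by blast
  next
    fix \<tau>
    assume "\<tau> \<in> ?f ` (?X \<times> ?Y)"
    then obtain p where p: "p \<in> ?X \<times> ?Y" "\<tau> = ?f p"
      by (rule imageE)
    obtain f \<sigma> where f\<sigma>: "p = (f, \<sigma>)"
      by (cases p)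
    have f: "f \<in> ?X" and \<sigma>: "\<sigma> \<in> tree_auts UNIV" "good (Suc n) \<sigma>"
      using p(1) unfolding f\<sigma> mem_Sigma_iff good_auts_def by blast+
    have \<rho>: "lift f \<in> tree_auts UNIV" "good (Suc n) (lift f)"
      using lift(1)[OF f] unfolding good_auts_def by blast+
    have "lift f \<circ> \<sigma> \<in> good_auts (Suc n)"
      using good_comp_iff[OF \<rho>(1) \<sigma>(1) \<rho>(2)] \<sigma>(2) tree_auts_comp[OF \<rho>(1) \<sigma>(1)]
      unfolding good_auts_def by blast
    then show "\<tau> \<in> res (Suc n) ` good_auts (Suc n)"
      unfolding p(2) f\<sigma> prod.case by (rule imageI)
  qed
  moreover have "card (?f ` (?X \<times> ?Y)) = card (id ` ?X) * card (res (Suc n) ` ?Y)"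
  proof (rule card_image_Times)
    fix f f' \<sigma> \<sigma>'
    assume f: "f \<in> ?X" "f' \<in> ?X" and \<sigma>: "\<sigma> \<in> ?Y" "\<sigma>' \<in> ?Y"
    have aut: "lift f \<in> tree_auts UNIV" "lift f' \<in> tree_auts UNIV"
      using lift(1)[OF f(1)] lift(1)[OF f(2)] by (simp_all add: good_auts_def)
    have "f = f'" if "agree (Suc n) (lift f \<circ> \<sigma>) (lift f' \<circ> \<sigma>')"
    proof -
      have "agree n (lift f \<circ> \<sigma>) (lift f)" "agree n (lift f' \<circ> \<sigma>') (lift f')"
        using \<sigma> agree_comp_left_iff[OF aut(1), of n \<sigma> id] agree_comp_left_iff[OF aut(2), of n \<sigma>' id]
        unfolding comp_id by blast+
      moreover have "agree n (lift f \<circ> \<sigma>) (lift f' \<circ> \<sigma>')"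
        using that by (rule agree_mono) simp
      ultimately have "agree n (lift f) (lift f')"
        using agree_trans agree_sym by blast
      then show ?thesis
        using lift(2)[OF f(1)] lift(2)[OF f(2)] by (simp only: res_eq_iff[symmetric])
    qed
    then show "?f (f, \<sigma>) = ?f (f', \<sigma>') \<longleftrightarrow> id f = id f' \<and> res (Suc n) \<sigma> = res (Suc n) \<sigma>'"
      unfolding prod.case res_eq_iff id_apply using agree_comp_left_iff[OF aut(1)] by blast
  qed
  ultimately show ?thesis
    by (simp add: E_fin_Suc_eq)
qed

text \<open>The logarithm of the recursion obtained by combining \<open>card_good_auts_Suc\<close>
  with \<open>card_good_auts\<close>.\<close>

lemma b_exp_Suc: "b_exp (Suc n) = 1 + 2 * b_exp n - real (n div 2)"
  by (cases "even n") (auto simp: b_exp_def add_divide_distrib elim!: evenE oddE)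

lemma e_exp_Suc: "e_exp (Suc n) = b_exp (Suc n) - b_exp n"
  by (cases "even n") (auto simp: b_exp_def e_exp_def add_divide_distrib elim!: evenE oddE)

lemma card_good_auts_eq: "real (card (res n ` good_auts n)) = 2 powr b_exp n"
proof (induction n)
  case 0
  have "res 0 ` good_auts 0 = {res 0 id}"
  proof -
    have "res 0 \<sigma> = res 0 id" if "\<sigma> \<in> tree_auts UNIV" for \<sigma>
      unfolding res_eq_iff by (simp add: agree_def tree_auts_root[OF that])
    moreover have "id \<in> good_auts 0"
      unfolding good_auts_def using tree_auts_id good_id by blast
    ultimately show ?thesis
      unfolding good_auts_def by blast
  qed
  moreover have "real (card {res 0 id}) = 2 powr b_exp 0"
    by (simp add: b_exp_def)
  ultimately show ?case
    by (simp only:)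
next
  case (Suc n)
  let ?c = "\<lambda>n. real (card (res n ` good_auts n))"
  have "?c (Suc n) * 2 ^ (n div 2) = 2 * ?c n * ?c n"
    unfolding card_good_auts_Suc card_good_auts[of n] by simp
  then have "?c (Suc n) = 2 * ?c n * ?c n / 2 ^ (n div 2)"
    by (simp add: field_simps)
  also have "\<dots> = 2 powr 1 * (2 powr b_exp n * 2 powr b_exp n) / 2 powr real (n div 2)"
    unfolding Suc by (simp add: powr_realpow)
  also have "\<dots> = 2 powr b_exp (Suc n)"
    by (simp only: b_exp_Suc powr_add[symmetric] powr_diff[symmetric] mult_2)
  finally show ?case .
qed

lemma card_E_fin_eq: "real (card (E_fin (Suc n))) = 2 powr e_exp (Suc n)"
proof -
  have "2 powr b_exp (Suc n) = 2 powr b_exp n * real (card (E_fin (Suc n)))"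
    using card_E_fin_Suc[of n] by (simp flip: card_good_auts_eq)
  then show ?thesis
    by (simp add: e_exp_Suc powr_diff)
qed

section \<open>The closure of the basilica group\<close>

lemma in_coset_U_lev_iff:
  assumes \<sigma>: "\<sigma> \<in> tree_auts UNIV"
  shows "\<rho> \<in> \<sigma> <#\<^bsub>Aut_inf\<^esub> U_lev m \<longleftrightarrow> \<rho> \<in> tree_auts UNIV \<and> agree m \<rho> \<sigma>"
proof
  assume "\<rho> \<in> \<sigma> <#\<^bsub>Aut_inf\<^esub> U_lev m"
  then obtain \<mu> where \<mu>: "\<mu> \<in> tree_auts UNIV" "\<rho> = \<sigma> \<circ> \<mu>" "\<forall>x. length x \<le> m \<longrightarrow> \<mu> x = x"
    using \<sigma> by (auto simp: l_coset_def U_lev_def carrier_Aut_inf mult_Aut_inf)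
  then show "\<rho> \<in> tree_auts UNIV \<and> agree m \<rho> \<sigma>"
    using tree_auts_comp[OF \<sigma> \<mu>(1)] by (simp add: agree_def)
next
  assume \<rho>: "\<rho> \<in> tree_auts UNIV \<and> agree m \<rho> \<sigma>"
  define \<mu> where "\<mu> = inv_into UNIV \<sigma> \<circ> \<rho>"
  have \<mu>: "\<mu> \<in> tree_auts UNIV" "\<sigma> \<circ> \<mu> = \<rho>"
    unfolding \<mu>_def using \<sigma> \<rho> by (simp_all only: tree_auts_comp tree_auts_inv comp_inv_cancel)
  have "agree m \<mu> id"
    using agree_comp_left_iff[OF \<sigma>, of m \<mu> id] \<rho> by (simp only: \<mu>(2) comp_id)
  then have "\<mu> \<in> U_lev m"
    using \<mu>(1) by (simp add: U_lev_def carrier_Aut_inf agree_def)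
  then show "\<rho> \<in> \<sigma> <#\<^bsub>Aut_inf\<^esub> U_lev m"
    using mult_Aut_inf[OF \<sigma> \<mu>(1)] \<mu>(2) unfolding l_coset_def by blast
qed

lemma openin_Aut_topology_coset:
  assumes "\<sigma> \<in> tree_auts UNIV"
  shows "openin Aut_topology (\<sigma> <#\<^bsub>Aut_inf\<^esub> U_lev m)"
  unfolding Aut_topology_def using assms
  by (intro topology_generated_by_Basis) (auto simp: carrier_Aut_inf)

text \<open>The cosets are given only as a subbasis. Induction over the generated topology shows
  that they form neighbourhood bases; an intersection takes the larger of two levels.\<close>

lemma openin_Aut_topology_nhd:
  assumes "openin Aut_topology T" "\<sigma> \<in> T"
  shows "\<exists>m. \<forall>\<rho>\<in>tree_auts UNIV. agree m \<rho> \<sigma> \<longrightarrow> \<rho> \<in> T"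
proof -
  have "generate_topology_on {\<sigma> <#\<^bsub>Aut_inf\<^esub> U_lev m | \<sigma> m. \<sigma> \<in> carrier Aut_inf} T"
    using assms(1) unfolding Aut_topology_def by (rule openin_topology_generated_by)
  then show ?thesis
    using assms(2)
  proof (induction arbitrary: \<sigma> rule: generate_topology_on.induct)
    case (Int a b)
    then obtain i j where "\<forall>\<rho>\<in>tree_auts UNIV. agree i \<rho> \<sigma> \<longrightarrow> \<rho> \<in> a"
      "\<forall>\<rho>\<in>tree_auts UNIV. agree j \<rho> \<sigma> \<longrightarrow> \<rho> \<in> b"
      by blast
    then show ?case
      by (intro exI[of _ "max i j"]) (blast intro: agree_mono max.cobounded1 max.cobounded2)
  next
    case (UN K)
    then show ?case
      by blast
  next
    case (Basis s)
    then obtain \<tau> m where \<tau>: "\<tau> \<in> tree_auts UNIV" "s = \<tau> <#\<^bsub>Aut_inf\<^esub> U_lev m"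
      by (auto simp: carrier_Aut_inf)
    then have "\<sigma> \<in> tree_auts UNIV" "agree m \<sigma> \<tau>"
      using Basis.prems in_coset_U_lev_iff by blast+
    then show ?case
      unfolding \<tau>(2) using in_coset_U_lev_iff[OF \<tau>(1)] agree_trans by blast
  qed simp
qed

lemma topspace_Aut_topology: "topspace Aut_topology = tree_auts UNIV"
proof
  show "topspace Aut_topology \<subseteq> tree_auts UNIV"
    unfolding Aut_topology_def using in_coset_U_lev_iff by (auto simp: carrier_Aut_inf)
  show "tree_auts UNIV \<subseteq> topspace Aut_topology"
    using openin_Aut_topology_coset in_coset_U_lev_iff agree_refl
    by (meson openin_subset subsetD subsetI)
qed

lemma in_B_inf_closure_iff:
  "\<sigma> \<in> B_inf_closure \<longleftrightarrow> \<sigma> \<in> tree_auts UNIV \<and> (\<forall>m. \<exists>\<tau>\<in>B_inf. agree m \<tau> \<sigma>)"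
proof (intro iffI conjI allI)
  assume \<sigma>: "\<sigma> \<in> B_inf_closure"
  then show aut: "\<sigma> \<in> tree_auts UNIV"
    by (simp add: B_inf_closure_def in_closure_of topspace_Aut_topology)
  fix m
  have "\<sigma> \<in> \<sigma> <#\<^bsub>Aut_inf\<^esub> U_lev m"
    using in_coset_U_lev_iff[OF aut] aut agree_refl by blast
  then obtain \<tau> where "\<tau> \<in> B_inf" "\<tau> \<in> \<sigma> <#\<^bsub>Aut_inf\<^esub> U_lev m"
    using \<sigma> openin_Aut_topology_coset[OF aut] unfolding B_inf_closure_def in_closure_of by blast
  then show "\<exists>\<tau>\<in>B_inf. agree m \<tau> \<sigma>"
    using in_coset_U_lev_iff[OF aut] by blast
next
  assume *: "\<sigma> \<in> tree_auts UNIV \<and> (\<forall>m. \<exists>\<tau>\<in>B_inf. agree m \<tau> \<sigma>)"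
  show "\<sigma> \<in> B_inf_closure"
    unfolding B_inf_closure_def in_closure_of topspace_Aut_topology
  proof (intro conjI allI impI)
    fix T
    assume "\<sigma> \<in> T \<and> openin Aut_topology T"
    then obtain m where "\<forall>\<rho>\<in>tree_auts UNIV. agree m \<rho> \<sigma> \<longrightarrow> \<rho> \<in> T"
      using openin_Aut_topology_nhd by blast
    then show "\<exists>y. y \<in> B_inf \<and> y \<in> T"
      using * B_inf_tree_auts by blast
  qed (use * in blast)
qed

lemma B_inf_closure_eq:
  "B_inf_closure = {\<sigma> \<in> tree_auts UNIV. \<forall>x. P_inv \<sigma> x = 1}"
proof (intro equalityI subsetI)
  fix \<sigma>
  assume "\<sigma> \<in> B_inf_closure"
  then have \<sigma>: "\<sigma> \<in> tree_auts UNIV" and approx: "\<And>m. \<exists>\<tau>\<in>B_inf. agree m \<tau> \<sigma>"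
    by (simp_all add: in_B_inf_closure_iff)
  have "P_inv \<sigma> x = 1" for x
  proof (rule two_adic_eq_if_dvd)
    fix k
    \<comment> \<open>This is the first level at which goodness controls P at x modulo
      2^(k+1).\<close>
    obtain \<tau> where "\<tau> \<in> B_inf" "agree (Suc (length x + 2 * k)) \<tau> \<sigma>"
      using approx by blast
    then have "good (Suc (length x + 2 * k)) \<sigma>"
      using good_agree good_B_inf by blast
    then have "2 ^ Suc k dvd P_inv \<sigma> x - 1"
      unfolding good_def by blast
    then show "2 ^ k dvd P_inv \<sigma> x - 1"
      by (rule dvd_trans[OF le_imp_power_dvd, rotated]) simp
  qed
  with \<sigma> show "\<sigma> \<in> {\<sigma> \<in> tree_auts UNIV. \<forall>x. P_inv \<sigma> x = 1}"
    by blast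
next
  fix \<sigma>
  assume "\<sigma> \<in> {\<sigma> \<in> tree_auts UNIV. \<forall>x. P_inv \<sigma> x = 1}"
  then have "\<sigma> \<in> tree_auts UNIV" "good n \<sigma>" for n
    by (simp_all add: good_def)
  then show "\<sigma> \<in> B_inf_closure"
    unfolding in_B_inf_closure_iff using good_imp_agree_B_inf by blast
qed

text \<open>On \<open>M_inf\<close> the value of P is constant over all nodes, so P = 1 at the root
  means P = 1 everywhere.\<close>

lemma kernel_P_inv_eq:
  "kernel M_inf two_adic_units (\<lambda>\<sigma>. P_inv \<sigma> []) = {\<sigma> \<in> tree_auts UNIV. \<forall>x. P_inv \<sigma> x = 1}"
proof -
  have "\<one>\<^bsub>two_adic_units\<^esub> = 1"
    by (simp add: two_adic_units_def units_of_def)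
  then show ?thesis
    by (auto simp: kernel_def M_inf_def carrier_Aut_inf)
qed

theorem theorem4p5:
  shows "(\<forall>n\<ge>1.
            real (card (E_fin n)) = 2 powr e_exp n \<and>
            real (card (B_fin n)) = 2 powr b_exp n \<and>
            real (card (B'_fin n)) = 2 powr b_exp n \<and>
            B_fin n = B'_fin n) \<and>
         B_inf_closure = kernel M_inf two_adic_units (\<lambda>\<sigma>. P_inv \<sigma> [])"
proof (intro conjI allI impI)
  fix n :: nat
  assume "1 \<le> n"
  then obtain m where "n = Suc m"
    by (cases n) auto
  then show "real (card (E_fin n)) = 2 powr e_exp n"
    by (simp add: card_E_fin_eq)
  show "real (card (B_fin n)) = 2 powr b_exp n" "real (card (B'_fin n)) = 2 powr b_exp n"
    "B_fin n = B'_fin n"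
    by (simp_all add: B_fin_eq B'_fin_eq card_good_auts_eq)
qed (simp add: B_inf_closure_eq kernel_P_inv_eq)

end
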